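(* Let $L$ be the matrix acting on vectors $U=\big((\mathbf f_{j_1,j_2})_{1\le j_1\le N_{v_1},1\le j_2\le N_{v_2}},\mathbf B,\mathbf E_2,\mathbf E_1\big)$, all components in $\mathbb R^{\tilde N}$, by $LU=\big((\mathbf f'_{j_1,j_2}),\mathbf B',\mathbf E_2',\mathbf E_1'\big)$ with $$\mathbf f'_{j_1,j_2}=v_{1,j_1}A\mathbf f_{j_1,j_2},\qquad \mathbf B'=A\mathbf E_2,$$ $$\mathbf E_2'=A\mathbf B-\Delta v_1\Delta v_2\sum_{j_1,j_2}v_{2,j_2}(\mathbf 1-\Pi)\mathbf f_{j_1,j_2},\qquad \mathbf E_1'=-\Delta v_1\Delta v_2\sum_{j_1,j_2}v_{1,j_1}(\mathbf 1-\Pi)\mathbf f_{j_1,j_2}.$$ Then $\exp(L\Delta t)$ is given by $\exp(L\Delta t)U=\big((\hat{\mathbf f}_{j_1,j_2}),\hat{\mathbf B},\hat{\mathbf E}_2,\hat{\mathbf E}_1\big)$ with $$\hat{\mathbf f}_{j_1,j_2}=e^{v_{1,j_1}A\Delta t}\,\mathbf f_{j_1,j_2},$$ $$\hat{\mathbf B}=\tfrac{e^{A\Delta t}+e^{-A\Delta t}}2\mathbf B+\tfrac{e^{A\Delta t}-e^{-A\Delta t}}2\mathbf E_2+\Delta v_1\Delta v_2(A+\Pi)^{-1}\sum_{j_1,j_2}v_{2,j_2}\,\alpha_{j_1}\mathbf f_{j_1,j_2},$$ $$\hat{\mathbf E}_2=\tfrac{e^{A\Delta t}-e^{-A\Delta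 t}}2\mathbf B+\tfrac{e^{A\Delta t}+e^{-A\Delta t}}2\mathbf E_2+\Delta v_1\Delta v_2(A+\Pi)^{-1}\sum_{j_1,j_2}v_{2,j_2}\,\beta_{j_1}\mathbf f_{j_1,j_2},$$ $$\hat{\mathbf E}_1=\mathbf E_1+\Delta v_1\Delta v_2(A+\Pi)^{-1}\sum_{j_1,j_2}\big(\mathbf 1-e^{v_{1,j_1}A\Delta t}\big)\mathbf f_{j_1,j_2},$$ where the $\tilde N\times\tilde N$ matrices $\alpha_{j_1},\beta_{j_1}$, $j_1=1,\dots,N_{v_1}$, are $$\alpha_{j_1}=\frac{-e^{A\Delta t}}{2(1-v_{1,j_1})}-\frac{e^{-A\Delta t}}{2(1+v_{1,j_1})}+\frac{e^{A\Delta t\,v_{1,j_1}}}{1-v_{1,j_1}^2},\qquad \beta_{j_1}=\frac{-e^{A\Delta t}}{2(1-v_{1,j_1})}+\frac{e^{-A\Delta t}}{2(1+v_{1,j_1})}+\frac{v_{1,j_1}e^{A\Delta t\,v_{1,j_1}}}{1-v_{1,j_1}^2}.$$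
   Context: DG matrix. Let $k\ge 0$, $N_x\ge1$ be integers, $L_0>0$, $\Delta x=L_0/N_x$, $\tilde N=(k+1)N_x$. A vector $\mathbf u\in\mathbb R^{\tilde N}$ is written as $\mathbf u=(\mathbf u_1,\dots,\mathbf u_{N_x})$ with $\mathbf u_i\in\mathbb R^{k+1}$ (DG coefficients in cell $i$ of the periodic interval $[0,L_0]$, in the basis $((x-x_i)/\Delta x)^m$, $m=0,\dots,k$, $x_i$ the cell center). Define $(k+1)\times(k+1)$ matrices, for $\ell,m=1,\dots,k+1$, by $M_{\ell,m}=\frac{(1/2)^{m+\ell-1}}{m+\ell-1}[1-(-1)^{m+\ell-1}]$, $(D_1)_{\ell,m}=(1/2)^{m+\ell-2}\big(\frac{\ell-1}{m+\ell-2}-\frac12\big)[1-(-1)^{m+\ell-2}]$ with $(D_1)_{1,1}=0$, $(D_2)_{\ell,m}=(-1)^m(1/2)^{m+\ell-1}$, $(D_3)_{\ell,m}=(-1)^{\ell-1}(1/2)^{m+\ell-1}$. The DG matrix $A\in\mathbb R^{\tilde N\times\tilde N}$ is the block circulant matrix acting by $(A\mathbf u)_i=\frac1{\Delta x}M^{-1}(D_1\mathbf u_i+D_2\mathbf u_{i+1}+D_3\mathbf u_{i-1})$, cell indices modulo $N_x$. $\mathbf 1$ is the identity matrix of size $\tilde N$, and $\Pi$ is the orthogonal projection onto $\mathrm{Ker}(A)$. Velocity grids: for $\ell=1,2$, $v_{\ell,\max}>0$, $\Delta v_\ell=2v_{\ell,\max}/N_{v_\ell}$, $v_{\ell,j}=-v_{\ell,\max}+j\Delta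 v_\ell$, $j=1,\dots,N_{v_\ell}$. Sums over $j_1,j_2$ run over $1\le j_1\le N_{v_1}$, $1\le j_2\le N_{v_2}$. $\Delta t>0$ is the time step. $L$ is the linear part of the DG (in $x$)/finite-difference (in velocity) semi-discretization of the 1dx-2dv Vlasov-Maxwell system.
   Formalization: Π is taken orthogonal for the L² (mass-matrix M) inner product of DG functions; with the Euclidean one the claim fails for k≥2 (e.g. k=2, N_x=1), and both agree for k=0,1. It is assumed that v_{1,j}≠±1, since α_j, β_j are otherwise undefined. *)

theory Defs
  imports Complex_Main
    "Jordan_Normal_Form.Matrix_Kernel"
    "Jordan_Normal_Form.Gauss_Jordan_Elimination"
begin

section \<open>Matrix exponential and inverse\<close>

text \<open>The power series is summed entrywise; it converges for every square real matrix.\<close>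

definition mat_exp :: "real mat \<Rightarrow> real mat" where
  "mat_exp X = mat (dim_row X) (dim_row X) (\<lambda>(i, j). \<Sum>n. (X ^\<^sub>m n) $$ (i, j) / fact n)"

text \<open>Only meaningful for invertible matrices.\<close>

definition mat_inv :: "real mat \<Rightarrow> real mat" where
  "mat_inv X = the (mat_inverse X)"


section \<open>The DG matrix\<close>

text \<open>
  With \<open>\<phi>\<^sub>l(\<xi>) = \<xi>^(l - 1)\<close> on the reference cell \<open>[-1/2, 1/2]\<close>, the entries are
  \<open>M = \<integral> \<phi>\<^sub>l \<phi>\<^sub>m\<close>,
  \<open>D1 = \<integral> \<phi>\<^sub>l' \<phi>\<^sub>m - 1/2 (\<phi>\<^sub>l \<phi>\<^sub>m)(1/2) + 1/2 (\<phi>\<^sub>l \<phi>\<^sub>m)(-1/2)\<close>,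
  \<open>D2 = - 1/2 \<phi>\<^sub>l(1/2) \<phi>\<^sub>m(-1/2)\<close> and \<open>D3 = 1/2 \<phi>\<^sub>l(-1/2) \<phi>\<^sub>m(1/2)\<close>
  (central fluxes).  The formulas use indices \<open>l, m\<close> starting from 1, whereas the matrix
  library counts from 0; hence the shift by 1 below.
\<close>

definition from_one :: "nat \<Rightarrow> (nat \<Rightarrow> nat \<Rightarrow> real) \<Rightarrow> real mat" where
  "from_one d a = mat d d (\<lambda>(i, j). a (i + 1) (j + 1))"

definition dg_M :: "nat \<Rightarrow> real mat" where
  "dg_M k = from_one (k + 1) (\<lambda>l m.
     (1/2) ^ (m + l - 1) / real (m + l - 1) * (1 - (-1) ^ (m + l - 1)))"

definition dg_D1 :: "nat \<Rightarrow> real mat" where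
  "dg_D1 k = from_one (k + 1) (\<lambda>l m.
     if l = 1 \<and> m = 1 then 0
     else (1/2) ^ (m + l - 2) * (real (l - 1) / real (m + l - 2) - 1/2)
            * (1 - (-1) ^ (m + l - 2)))"

definition dg_D2 :: "nat \<Rightarrow> real mat" where
  "dg_D2 k = from_one (k + 1) (\<lambda>l m. (-1) ^ m * (1/2) ^ (m + l - 1))"

definition dg_D3 :: "nat \<Rightarrow> real mat" where
  "dg_D3 k = from_one (k + 1) (\<lambda>l m. (-1) ^ (l - 1) * (1/2) ^ (m + l - 1))"

text \<open>
  Cells are numbered \<open>0, \<dots>, Nx - 1\<close>; entry \<open>i * (k + 1) + l\<close> of a coefficient vector is the
  \<open>l\<close>-th coefficient in cell \<open>i\<close>.
\<close>

definition cell :: "nat \<Rightarrow> real vec \<Rightarrow> nat \<Rightarrow> real vec" where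
  "cell k u i = vec (k + 1) (\<lambda>l. u $ (i * (k + 1) + l))"

text \<open>
  The three contributions are added, since the neighbours \<open>i + 1\<close> and \<open>i - 1\<close> coincide with each
  other for \<open>Nx = 2\<close>, and with \<open>i\<close> for \<open>Nx = 1\<close>.  The block action is
  \<open>cell_dg_matrix_mult_vec\<close> below.
\<close>

definition dg_matrix :: "nat \<Rightarrow> nat \<Rightarrow> real \<Rightarrow> real mat" where
  "dg_matrix k Nx dx = mat ((k + 1) * Nx) ((k + 1) * Nx) (\<lambda>(r, c).
     let i = r div (k + 1); l = r mod (k + 1);
         i' = c div (k + 1); m = c mod (k + 1);
         W = mat_inv (dg_M k)
     in 1 / dx *
          ((if i' = i then (W * dg_D1 k) $$ (l, m) else 0)
         + (if i' = (i + 1) mod Nx then (W * dg_D2 k) $$ (l, m) else 0)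
         + (if i' = (i + Nx - 1) mod Nx then (W * dg_D3 k) $$ (l, m) else 0)))"


section \<open>The projection onto the kernel\<close>

text \<open>
  Orthogonality is that of the DG functions in \<open>L\<^sup>2(0, L0)\<close>: \<open>dg_inner k Nx dx u w\<close> is the
  integral of the product of the piecewise polynomials with coefficient vectors \<open>u\<close> and \<open>w\<close>.
  As the monomial basis is not orthogonal, this is not the Euclidean inner product of the
  coefficient vectors.  \<open>A\<close> is skew-adjoint for \<open>dg_inner\<close>, but in general not for the
  Euclidean inner product: for \<open>k \<ge> 2\<close> the Euclidean orthogonal projection onto the kernel
  does not commute with \<open>A\<close>.
\<close>

definition dg_inner :: "nat \<Rightarrow> nat \<Rightarrow> real \<Rightarrow> real vec \<Rightarrow> real vec \<Rightarrow> real" where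
  "dg_inner k Nx dx u w = dx * (\<Sum>i<Nx. cell k u i \<bullet> (dg_M k *\<^sub>v cell k w i))"

definition is_orthogonal_projection ::
  "nat \<Rightarrow> (real vec \<Rightarrow> real vec \<Rightarrow> real) \<Rightarrow> real vec set \<Rightarrow> real mat \<Rightarrow> bool" where
  "is_orthogonal_projection n ip S P \<longleftrightarrow>
     P \<in> carrier_mat n n \<and>
     (\<forall>u \<in> carrier_vec n. P *\<^sub>v u \<in> S \<and> (\<forall>w \<in> S. ip (u - P *\<^sub>v u) w = 0))"


section \<open>Velocity grid and state vectors\<close>

definition vel_step :: "real \<Rightarrow> nat \<Rightarrow> real" where
  "vel_step vmax Nv = 2 * vmax / real Nv"

definition vel :: "real \<Rightarrow> nat \<Rightarrow> nat \<Rightarrow> real" where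
  "vel vmax Nv j = - vmax + real j * vel_step vmax Nv"

text \<open>
  The vector \<open>U = ((f j1 j2), B, E2, E1)\<close> as the concatenation of its \<open>Nv1 * Nv2 + 3\<close> blocks of
  length \<open>n\<close>; the blocks \<open>f j1 j2\<close> (\<open>1 \<le> j1 \<le> Nv1\<close>, \<open>1 \<le> j2 \<le> Nv2\<close>) come in lexicographic order.
\<close>

definition state_dim :: "nat \<Rightarrow> nat \<Rightarrow> nat \<Rightarrow> nat" where
  "state_dim n Nv1 Nv2 = (Nv1 * Nv2 + 3) * n"

definition state ::
  "nat \<Rightarrow> nat \<Rightarrow> nat \<Rightarrow> (nat \<Rightarrow> nat \<Rightarrow> real vec) \<Rightarrow> real vec \<Rightarrow> real vec \<Rightarrow> real vec \<Rightarrow> real vec" where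
  "state n Nv1 Nv2 f B E2 E1 = vec (state_dim n Nv1 Nv2) (\<lambda>r.
     let b = r div n; s = r mod n in
     if b < Nv1 * Nv2 then f (b div Nv2 + 1) (b mod Nv2 + 1) $ s
     else if b = Nv1 * Nv2 then B $ s
     else if b = Nv1 * Nv2 + 1 then E2 $ s
     else E1 $ s)"

abbreviation vel_sum ::
  "nat \<Rightarrow> nat \<Rightarrow> nat \<Rightarrow> (nat \<Rightarrow> nat \<Rightarrow> real vec) \<Rightarrow> real vec" where
  "vel_sum n Nv1 Nv2 g \<equiv> finsum_vec TYPE(real) n (\<lambda>(j1, j2). g j1 j2) ({1..Nv1} \<times> {1..Nv2})"


section \<open>Block action of the DG matrix\<close>

lemma sum_blocks:
  fixes g :: "nat \<Rightarrow> real"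
  shows "(\<Sum>c<d * N. g c) = (\<Sum>i<N. \<Sum>m<d. g (i * d + m))"
proof (induction N)
  case (Suc N)
  have "(\<Sum>c<d * Suc N. g c) = (\<Sum>c<d * N. g c) + (\<Sum>m<d. g (N * d + m))"
  proof -
    have "{..<d * Suc N} = {..<d * N} \<union> (\<lambda>m. N * d + m) ` {..<d}"
    proof (intro equalityI subsetI)
      fix c assume "c \<in> {..<d * Suc N}"
      then show "c \<in> {..<d * N} \<union> (\<lambda>m. N * d + m) ` {..<d}"
        by (cases "c < d * N") (auto simp: algebra_simps intro!: image_eqI[of _ _ "c - N * d"])
    qed (auto simp: algebra_simps)
    moreover have "{..<d * N} \<inter> (\<lambda>m. N * d + m) ` {..<d} = {}"
      by (auto simp: algebra_simps)
    ultimately show ?thesis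
      by (simp add: sum.union_disjoint sum.reindex inj_on_def)
  qed
  then show ?case using Suc by simp
qed simp

lemma div_mod_block:
  fixes a b d :: nat
  assumes "b < d"
  shows "(a * d + b) div d = a" and "(a * d + b) mod d = b"
  using assms by auto

lemma cell_dg_matrix_mult_vec:
  assumes inv: "mat_inv (dg_M k) \<in> carrier_mat (k + 1) (k + 1)"
    and u: "u \<in> carrier_vec ((k + 1) * Nx)" and i: "i < Nx"
  shows "cell k (dg_matrix k Nx dx *\<^sub>v u) i =
    (1 / dx) \<cdot>\<^sub>v (mat_inv (dg_M k) *\<^sub>v
       (dg_D1 k *\<^sub>v cell k u i + dg_D2 k *\<^sub>v cell k u ((i + 1) mod Nx)
        + dg_D3 k *\<^sub>v cell k u ((i + Nx - 1) mod Nx)))"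
    (is "_ = ?rhs")
proof (rule eq_vecI)
  let ?W = "mat_inv (dg_M k)" and ?d = "k + 1"
  let ?i2 = "(i + 1) mod Nx" and ?i3 = "(i + Nx - 1) mod Nx"
  show "dim_vec (cell k (dg_matrix k Nx dx *\<^sub>v u) i) = dim_vec ?rhs"
    using inv by (simp add: cell_def)
  fix l assume "l < dim_vec ?rhs"
  then have l: "l < ?d" using inv by simp
  have D: "dg_D1 k \<in> carrier_mat ?d ?d" "dg_D2 k \<in> carrier_mat ?d ?d" "dg_D3 k \<in> carrier_mat ?d ?d"
    by (simp_all add: dg_D1_def dg_D2_def dg_D3_def from_one_def)
  have C: "cell k u j \<in> carrier_vec ?d" for j by (simp add: cell_def)
  have nz: "Nx > 0" using i by simp
  have r: "i * ?d + l < ?d * Nx"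
  proof -
    have "i * ?d + l < Suc i * ?d" using l by simp
    also have "\<dots> \<le> Nx * ?d" using i by (intro mult_le_mono1) simp
    finally show ?thesis by (simp add: mult.commute)
  qed
  have blk: "(i' * ?d + m) < ?d * Nx" if "i' < Nx" "m < ?d" for i' m
  proof -
    have "i' * ?d + m < Suc i' * ?d" using that by simp
    also have "\<dots> \<le> Nx * ?d" using that by (intro mult_le_mono1) simp
    finally show ?thesis by (simp add: mult.commute)
  qed
  have dm: "(a * ?d + b) div ?d = a" "(a * ?d + b) mod ?d = b" if "b < ?d" for a b
    using that by (rule div_mod_block)+
  have W: "((?W * X) *\<^sub>v cell k u j) $ l = (\<Sum>m<?d. (?W * X) $$ (l, m) * u $ (j * ?d + m))"
    if "X \<in> carrier_mat ?d ?d" for X j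
  proof -
    define Y where "Y = ?W * X"
    have Y: "Y \<in> carrier_mat ?d ?d" using that inv by (simp add: Y_def)
    have "(Y *\<^sub>v cell k u j) $ l = (\<Sum>m<?d. Y $$ (l, m) * cell k u j $ m)"
      using Y l C[of j] by (simp add: scalar_prod_def lessThan_atLeast0 del: sum.op_ivl_Suc)
    then show ?thesis by (simp add: Y_def cell_def del: sum.lessThan_Suc)
  qed
  have "cell k (dg_matrix k Nx dx *\<^sub>v u) i $ l
      = (\<Sum>c<?d * Nx. dg_matrix k Nx dx $$ (i * ?d + l, c) * u $ c)"
    using l r u by (simp add: cell_def dg_matrix_def scalar_prod_def lessThan_atLeast0)
  also have "\<dots> = (\<Sum>i'<Nx. \<Sum>m<?d. dg_matrix k Nx dx $$ (i * ?d + l, i' * ?d + m) * u $ (i' * ?d + m))"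
    by (rule sum_blocks)
  also have "\<dots> = (\<Sum>i'<Nx. \<Sum>m<?d. 1 / dx *
       ((if i' = i then (?W * dg_D1 k) $$ (l, m) * u $ (i' * ?d + m) else 0)
      + (if i' = ?i2 then (?W * dg_D2 k) $$ (l, m) * u $ (i' * ?d + m) else 0)
      + (if i' = ?i3 then (?W * dg_D3 k) $$ (l, m) * u $ (i' * ?d + m) else 0)))"
  proof (intro sum.cong refl)
    fix i' m assume "i' \<in> {..<Nx}" "m \<in> {..<?d}"
    then have *: "i' < Nx" "m < ?d" by auto
    have "dg_matrix k Nx dx $$ (i * ?d + l, i' * ?d + m) = 1 / dx *
       ((if i' = i then (?W * dg_D1 k) $$ (l, m) else 0)
      + (if i' = ?i2 then (?W * dg_D2 k) $$ (l, m) else 0)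
      + (if i' = ?i3 then (?W * dg_D3 k) $$ (l, m) else 0))"
      unfolding dg_matrix_def index_mat(1)[OF r blk[OF *]] prod.case dm[OF l] dm[OF *(2)] Let_def ..
    then show "dg_matrix k Nx dx $$ (i * ?d + l, i' * ?d + m) * u $ (i' * ?d + m) = 1 / dx *
       ((if i' = i then (?W * dg_D1 k) $$ (l, m) * u $ (i' * ?d + m) else 0)
      + (if i' = ?i2 then (?W * dg_D2 k) $$ (l, m) * u $ (i' * ?d + m) else 0)
      + (if i' = ?i3 then (?W * dg_D3 k) $$ (l, m) * u $ (i' * ?d + m) else 0))"
      by (simp only: mult.assoc distrib_right) (auto simp: distrib_right)
  qed
  also have "\<dots> = 1 / dx *
     ((\<Sum>m<?d. (?W * dg_D1 k) $$ (l, m) * u $ (i * ?d + m))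
    + (\<Sum>m<?d. (?W * dg_D2 k) $$ (l, m) * u $ (?i2 * ?d + m))
    + (\<Sum>m<?d. (?W * dg_D3 k) $$ (l, m) * u $ (?i3 * ?d + m)))"
  proof -
    have pick: "(\<Sum>i'<Nx. \<Sum>m<?d. if i' = j then g i' m else 0) = (\<Sum>m<?d. g j m)"
      if "j < Nx" for j and g :: "nat \<Rightarrow> nat \<Rightarrow> real"
      by (subst sum.swap) (use that in \<open>simp add: sum.delta'\<close>)
    have "?i2 < Nx" "?i3 < Nx" using nz by auto
    then show ?thesis
      unfolding sum_distrib_left[symmetric] sum.distrib by (simp only: pick i)
  qed
  also have "\<dots> = 1 / dx * (((?W * dg_D1 k) *\<^sub>v cell k u i) $ l
      + ((?W * dg_D2 k) *\<^sub>v cell k u ?i2) $ l + ((?W * dg_D3 k) *\<^sub>v cell k u ?i3) $ l)"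
    by (simp only: W[OF D(1)] W[OF D(2)] W[OF D(3)])
  also have "\<dots> = ?rhs $ l"
  proof -
    have "?W *\<^sub>v (dg_D1 k *\<^sub>v cell k u i + dg_D2 k *\<^sub>v cell k u ?i2 + dg_D3 k *\<^sub>v cell k u ?i3)
      = (?W * dg_D1 k) *\<^sub>v cell k u i + (?W * dg_D2 k) *\<^sub>v cell k u ?i2
        + (?W * dg_D3 k) *\<^sub>v cell k u ?i3"
      using inv D C
      by (simp add: mult_add_distrib_mat_vec[where nr = "?d" and nc = "?d"]
          assoc_mult_mat_vec[where ?n\<^sub>1.0 = "?d" and ?n\<^sub>2.0 = "?d" and ?n\<^sub>3.0 = "?d"])
    then show ?thesis using l inv D C by simp
  qed
  finally show "cell k (dg_matrix k Nx dx *\<^sub>v u) i $ l = ?rhs $ l" .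
qed

end

theory Submission
  imports Defs
begin

text \<open>
  \<open>A\<close> is skew-adjoint for the \<open>L\<^sup>2\<close> inner product, so its range is orthogonal to its kernel and
  \<open>A P = P A = 0\<close>.  Hence \<open>A + P\<close> is invertible, its inverse commutes with \<open>A\<close>, and
  \<open>(A + P)\<^sup>-\<^sup>1 A = 1 - P\<close>.  Consequently every block of \<open>L ^ m U\<close> is, up to a factor \<open>(A + P)\<^sup>-\<^sup>1\<close>,
  a combination of vectors \<open>A ^ m w\<close> with scalar coefficients that satisfy a two-term recursion in
  \<open>m\<close>; summing against \<open>dt ^ m / m!\<close> turns them into the exponentials of the claim.
\<close>

section \<open>Skew-adjointness of the DG matrix\<close>

text \<open>Constants lie in the kernel of \<open>A\<close>, so the currents cannot be integrated in
  time by dividing by \<open>A\<close>. The projection removes this obstacle: \<open>1 - P\<close>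
  has the form \<open>G A\<close> with \<open>G\<close> the inverse of \<open>A + P\<close>, and
  this factor \<open>A\<close> cancels the one that integration puts into the denominator. The
  combinations \<open>E2 + B\<close> and \<open>E2 - B\<close> evolve with generators
  \<open>A\<close> and \<open>-A\<close> and are driven by sources proportional to exp(v t A).
  Duhamel's formula would give the denominators 1 - v and 1 + v, with resonances at v = 1 and v =
  -1. Its particular solution is v^m / (1 - v^2), the homogeneous ones are 1 and (-1)^m, and the two
  initial values fix their weights. These are the three terms of \<alpha>; \<beta> belongs to the
  shifted sequence. Positive definiteness of the mass matrix is used twice: for its inverse, which
  enters \<open>A\<close>, and for the definiteness of the inner product.\<close>

lemma eq_mat_if_eq_mult_vec:
  fixes X Y :: "'a :: comm_ring_1 mat"
  assumes "X \<in> carrier_mat r n" "Y \<in> carrier_mat r n"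
    and "\<And>v. v \<in> carrier_vec n \<Longrightarrow> X *\<^sub>v v = Y *\<^sub>v v"
  shows "X = Y"
proof (rule eq_matI)
  fix i j assume ij: "i < dim_row Y" "j < dim_col Y"
  have "Z $$ (i, j) = (Z *\<^sub>v unit_vec n j) $ i" if "Z \<in> carrier_mat r n" for Z :: "'a mat"
    using that ij assms(2) by simp
  then show "X $$ (i, j) = Y $$ (i, j)"
    using assms by simp
qed (use assms in auto)

text \<open>A trivial kernel forces a nonzero determinant, so \<open>mat_inverse\<close> does not
  return \<open>None\<close> and \<open>mat_inv\<close> denotes a genuine inverse. Serves both the
  mass matrix and \<open>A + P\<close>.\<close>

lemma mat_inv_if_trivial_kernel:
  assumes A: "A \<in> carrier_mat n n"
    and ker: "\<And>v. v \<in> carrier_vec n \<Longrightarrow> A *\<^sub>v v = 0\<^sub>v n \<Longrightarrow> v = 0\<^sub>v n"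
  shows "mat_inv A \<in> carrier_mat n n" "A * mat_inv A = 1\<^sub>m n" "mat_inv A * A = 1\<^sub>m n"
proof -
  have "det A \<noteq> 0" using ker det_0_iff_vec_prod_zero_field[OF A] by blast
  then have "A \<in> Units (ring_mat TYPE(real) n ())" by (rule det_non_zero_imp_unit[OF A])
  then obtain W where "mat_inverse A = Some W"
    using mat_inverse(1)[OF A, of "()"] by (cases "mat_inverse A") auto
  then show "mat_inv A \<in> carrier_mat n n" "A * mat_inv A = 1\<^sub>m n" "mat_inv A * A = 1\<^sub>m n"
    using mat_inverse(2)[OF A] by (simp_all add: mat_inv_def)
qed

text \<open>Taken with \<open>Y = X\<close> for \<open>dg_D1\<close>, and with \<open>dg_D2\<close>,
  \<open>dg_D3\<close> for \<open>X\<close>, \<open>Y\<close>, where it trades the flux from the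
  right neighbour for the flux from the left one.\<close>

lemma scalar_prod_transpose_eq_uminus:
  fixes X Y :: "real mat"
  assumes X: "X \<in> carrier_mat d d" and "transpose_mat X = - Y"
    and "x \<in> carrier_vec d" "y \<in> carrier_vec d"
  shows "x \<bullet> (X *\<^sub>v y) = - (y \<bullet> (Y *\<^sub>v x))"
proof -
  have Y: "Y \<in> carrier_mat d d" using assms(2) X
    by (metis transpose_carrier_mat uminus_carrier_iff_mat)
  have "x \<bullet> (X *\<^sub>v y) = ((- Y) *\<^sub>v x) \<bullet> y"
    using transpose_vec_mult_scalar[OF X assms(4,3)] assms(2) by simp
  also have "\<dots> = - (y \<bullet> (Y *\<^sub>v x))"
    using Y assms(3,4) by (simp add: comm_scalar_prod[of y d "Y *\<^sub>v x"])
  finally show ?thesis .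
qed

section \<open>Matrices of the reference cell: positivity of the mass matrix and discrete
  integration by parts\<close>

lemma dg_M_index:
  assumes "i < k + 1" "j < k + 1"
  shows "dg_M k $$ (i, j) = ((1/2) ^ (i + j + 1) - (-1/2) ^ (i + j + 1)) / real (i + j + 1)"
proof -
  have "(-1/2 :: real) ^ m = (-1) ^ m * (1/2) ^ m" for m
    by (simp flip: power_mult_distrib)
  then show ?thesis
    using assms by (simp add: dg_M_def from_one_def algebra_simps)
qed

lemma dg_carrier [simp]:
  "dg_M k \<in> carrier_mat (k + 1) (k + 1)" "dg_D1 k \<in> carrier_mat (k + 1) (k + 1)"
  "dg_D2 k \<in> carrier_mat (k + 1) (k + 1)" "dg_D3 k \<in> carrier_mat (k + 1) (k + 1)"
  by (simp_all add: dg_M_def dg_D1_def dg_D2_def dg_D3_def from_one_def)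

lemmas dg_carrier_Suc [simp] = dg_carrier[unfolded Suc_eq_plus1[symmetric]]

text \<open>
  \<open>F (1/2) - F (-1/2)\<close> below is the integral of \<open>p\<^sup>2\<close> over the reference cell.  If it vanishes, the
  nondecreasing antiderivative \<open>F\<close> is constant there, so \<open>p\<close> has infinitely many roots.
\<close>

lemma dg_M_pos_def:
  assumes u: "u \<in> carrier_vec (k + 1)"
  shows "u \<bullet> (dg_M k *\<^sub>v u) \<ge> 0"
    and "u \<bullet> (dg_M k *\<^sub>v u) = 0 \<Longrightarrow> u = 0\<^sub>v (k + 1)"
proof -
  define d where "d = k + 1"
  define p where "p x = (\<Sum>i<d. u $ i * x ^ i)" for x
  define F where "F x = (\<Sum>i<d. \<Sum>j<d. u $ i * u $ j * (x ^ (i + j + 1) / real (i + j + 1)))" for x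
  have M: "dg_M k \<in> carrier_mat d d" by (simp add: d_def)
  have form: "u \<bullet> (dg_M k *\<^sub>v u) = F (1/2) - F (-1/2)"
  proof -
    have "u \<bullet> (dg_M k *\<^sub>v u) = (\<Sum>i<d. \<Sum>j<d. u $ i * u $ j * dg_M k $$ (i, j))"
      using u M unfolding d_def[symmetric]
      by (simp add: scalar_prod_def lessThan_atLeast0 sum_distrib_left mult_ac)
    also have "\<dots> = (\<Sum>i<d. \<Sum>j<d. u $ i * u $ j *
        (((1/2) ^ (i + j + 1) - (-1/2) ^ (i + j + 1)) / real (i + j + 1)))"
      by (intro sum.cong refl arg_cong2[of _ _ _ _ "(*)"] dg_M_index) (auto simp: d_def)
    also have "\<dots> = F (1/2) - F (-1/2)"
      unfolding F_def sum_subtractf[symmetric] by (simp only: diff_divide_distrib right_diff_distrib)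
    finally show ?thesis .
  qed
  have deriv: "(F has_real_derivative (p x)\<^sup>2) (at x)" for x
  proof -
    have "(F has_real_derivative (\<Sum>i<d. \<Sum>j<d. u $ i * u $ j * x ^ (i + j))) (at x)"
      unfolding F_def
    proof (intro DERIV_sum DERIV_cmult)
      fix i j
      have "((\<lambda>x. x ^ (i + j + 1) / real (i + j + 1)) has_real_derivative
          real (i + j + 1) * x ^ (i + j) / real (i + j + 1)) (at x)"
        by (rule DERIV_cdivide) (use DERIV_pow[of "i + j + 1" x] in simp)
      then show "((\<lambda>x. x ^ (i + j + 1) / real (i + j + 1)) has_real_derivative x ^ (i + j)) (at x)"
        by simp
    qed
    moreover have "(\<Sum>i<d. \<Sum>j<d. u $ i * u $ j * x ^ (i + j)) = (p x)\<^sup>2"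
      by (simp add: p_def power2_eq_square sum_product power_add mult_ac)
    ultimately show ?thesis by simp
  qed
  have mono: "F x \<le> F y" if "x \<le> y" for x y
    using that deriv zero_le_power2 by (intro DERIV_nonneg_imp_nondecreasing[of x y F]) blast+
  show "u \<bullet> (dg_M k *\<^sub>v u) \<ge> 0" using mono[of "-1/2" "1/2"] form by simp
  assume "u \<bullet> (dg_M k *\<^sub>v u) = 0"
  then have const: "F x = F 0" if "\<bar>x\<bar> \<le> 1/2" for x
    using form mono[of "-1/2" x] mono[of x "1/2"] mono[of "-1/2" 0] mono[of 0 "1/2"] that
    by (intro antisym) (auto simp: abs_le_iff)
  have "p x = 0" if "\<bar>x\<bar> < 1/2" for x
  proof -
    have "(p x)\<^sup>2 = 0"
    proof (rule DERIV_local_const[OF deriv])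
      \<comment> \<open>The radius is the distance from \<open>x\<close> to the nearer end of the
        cell; \<open>F\<close> is constant on this neighbourhood, so its derivative at
        \<open>x\<close> is zero.\<close>
      show "0 < 1/2 - \<bar>x\<bar>" using that by simp
      show "\<forall>y. \<bar>x - y\<bar> < 1/2 - \<bar>x\<bar> \<longrightarrow> F x = F y"
        using const[of x] const that by (smt (verit))
    qed
    then show ?thesis by simp
  qed
  then have "{-1/2<..<1/2} \<subseteq> {z. (\<Sum>i\<le>k. u $ i * z ^ i) = 0}"
    by (auto simp: p_def d_def lessThan_Suc_atMost abs_less_iff)
  then have "infinite {z. (\<Sum>i\<le>k. u $ i * z ^ i) = 0}"
    by (rule infinite_super) (rule infinite_Ioo, simp)
  then have "u $ i = 0" if "i \<le> k" for i
    using polyfun_rootbound[of "\<lambda>i. u $ i" i k] that by blast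
  then show "u = 0\<^sub>v (k + 1)" using u by (intro eq_vecI) auto
qed

text \<open>For \<open>dg_D1\<close> this is integration by parts: the volume term plus its
  transpose equals the boundary term, and the central flux subtracts half of that term from
  each.\<close>

lemma transpose_dg:
  "transpose_mat (dg_M k) = dg_M k" "transpose_mat (dg_D1 k) = - dg_D1 k"
  "transpose_mat (dg_D2 k) = - dg_D3 k"
proof -
  show "transpose_mat (dg_M k) = dg_M k"
    by (rule eq_matI) (auto simp: dg_M_def from_one_def add.commute)
  show "transpose_mat (dg_D2 k) = - dg_D3 k"
    by (rule eq_matI) (auto simp: dg_D2_def dg_D3_def from_one_def add.commute)
  show "transpose_mat (dg_D1 k) = - dg_D1 k"
  proof (rule eq_matI)
    fix i j assume "i < dim_row (- dg_D1 k)" "j < dim_col (- dg_D1 k)"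
    then have ij: "i < k + 1" "j < k + 1" by (auto simp: dg_D1_def from_one_def)
    show "transpose_mat (dg_D1 k) $$ (i, j) = (- dg_D1 k) $$ (i, j)"
    proof (cases "i + j = 0")
      case True
      then show ?thesis using ij by (simp add: dg_D1_def from_one_def)
    next
      case False
      \<comment> \<open>With indices from 0, the fractions \<open>x\<close> and \<open>y\<close> add
        up to 1 and so deviate from 1/2 by opposite amounts. The corner entry was split off because
        its quotient would be 0/0.\<close>
      define x y where "x = real i / real (i + j)" and "y = real j / real (i + j)"
      have "x + y = 1"
        using False unfolding x_def y_def add_divide_distrib[symmetric] of_nat_add[symmetric]
        by (simp del: of_nat_add)
      then have y: "y - 1/2 = - (x - 1/2)" by simp
      have "transpose_mat (dg_D1 k) $$ (i, j) = (1/2) ^ (i + j) * (y - 1/2) * (1 - (-1) ^ (i + j))"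
        using ij False by (auto simp: dg_D1_def from_one_def y_def add.commute)
      moreover have "dg_D1 k $$ (i, j) = (1/2) ^ (i + j) * (x - 1/2) * (1 - (-1) ^ (i + j))"
        using ij False by (auto simp: dg_D1_def from_one_def x_def add.commute)
      moreover have "(- dg_D1 k) $$ (i, j) = - (dg_D1 k $$ (i, j))"
        using ij carrier_matD[OF dg_carrier(2)[of k]] by simp
      ultimately show ?thesis unfolding y by (simp only: mult_minus_left mult_minus_right)
    qed
  qed (auto simp: dg_D1_def from_one_def)
qed

lemma dg_M_mat_inv:
  "mat_inv (dg_M k) \<in> carrier_mat (k + 1) (k + 1)" "dg_M k * mat_inv (dg_M k) = 1\<^sub>m (k + 1)"
proof -
  have "v = 0\<^sub>v (k + 1)" if "v \<in> carrier_vec (k + 1)" "dg_M k *\<^sub>v v = 0\<^sub>v (k + 1)" for v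
    using dg_M_pos_def(2)[of v k] that by simp
  from mat_inv_if_trivial_kernel[OF dg_carrier(1) this]
  show "mat_inv (dg_M k) \<in> carrier_mat (k + 1) (k + 1)" "dg_M k * mat_inv (dg_M k) = 1\<^sub>m (k + 1)"
    by auto
qed

section \<open>The inner product of DG functions and summation by parts on the periodic mesh\<close>

lemma cell_carrier [simp]: "cell k u i \<in> carrier_vec (k + 1)"
  by (simp add: cell_def)

lemmas cell_carrier_Suc [simp] = cell_carrier[unfolded Suc_eq_plus1[symmetric]]

lemma dg_inner_commute: "dg_inner k Nx dx u w = dg_inner k Nx dx w u"
proof -
  have "cell k u i \<bullet> (dg_M k *\<^sub>v cell k w i) = cell k w i \<bullet> (dg_M k *\<^sub>v cell k u i)" for i
    using transpose_vec_mult_scalar[OF dg_carrier(1) cell_carrier cell_carrier, of k w i u i]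
    unfolding transpose_dg
    using comm_scalar_prod[OF cell_carrier mult_mat_vec_carrier[OF dg_carrier(1) cell_carrier], of k u i w i]
    by simp
  then show ?thesis by (simp add: dg_inner_def)
qed

lemma block_index_less:
  fixes i l d N :: nat
  assumes "i < N" "l < d"
  shows "i * d + l < d * N"
proof -
  have "i * d + l < Suc i * d" using assms by simp
  also have "\<dots> \<le> N * d" using assms by (intro mult_le_mono1) simp
  finally show ?thesis by (simp add: mult.commute)
qed

lemma dg_inner_minus_left:
  assumes "u \<in> carrier_vec ((k + 1) * Nx)" "v \<in> carrier_vec ((k + 1) * Nx)"
  shows "dg_inner k Nx dx (u - v) w = dg_inner k Nx dx u w - dg_inner k Nx dx v w"
proof -
  have "cell k (u - v) i = cell k u i - cell k v i" if "i < Nx" for i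
  proof (rule eq_vecI)
    fix l assume "l < dim_vec (cell k u i - cell k v i)"
    then have l: "l < k + 1" by (simp add: cell_def)
    have "(u - v) $ (i * (k + 1) + l) = u $ (i * (k + 1) + l) - v $ (i * (k + 1) + l)"
      using block_index_less[OF that l] assms(2) by (intro index_minus_vec) simp
    then show "cell k (u - v) i $ l = (cell k u i - cell k v i) $ l"
      using l by (simp add: cell_def)
  qed (simp add: cell_def)
  then have "cell k (u - v) i \<bullet> (dg_M k *\<^sub>v cell k w i) =
      cell k u i \<bullet> (dg_M k *\<^sub>v cell k w i) - cell k v i \<bullet> (dg_M k *\<^sub>v cell k w i)" if "i < Nx" for i
    using that minus_scalar_prod_distrib[OF cell_carrier cell_carrier
        mult_mat_vec_carrier[OF dg_carrier(1) cell_carrier], of k u i v i w i]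
    by simp
  then show ?thesis
    by (simp add: dg_inner_def sum_subtractf right_diff_distrib)
qed

text \<open>The cell contributions are nonnegative, so a vanishing sum makes each of them vanish,
  and definiteness of the mass matrix applies cell by cell.\<close>

lemma dg_inner_definite:
  assumes u: "u \<in> carrier_vec ((k + 1) * Nx)" and "dx > 0" and "dg_inner k Nx dx u u = 0"
  shows "u = 0\<^sub>v ((k + 1) * Nx)"
proof -
  have "(\<Sum>i<Nx. cell k u i \<bullet> (dg_M k *\<^sub>v cell k u i)) = 0"
    using assms by (simp add: dg_inner_def)
  then have 0: "cell k u i = 0\<^sub>v (k + 1)" if "i < Nx" for i
    using that dg_M_pos_def[OF cell_carrier, of k u] by (simp add: sum_nonneg_eq_0_iff)
  show ?thesis
  proof (rule eq_vecI)
    fix r assume "r < dim_vec (0\<^sub>v ((k + 1) * Nx))"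
    then have r: "r < (k + 1) * Nx" by simp
    then have "r div (k + 1) < Nx" by (simp add: less_mult_imp_div_less mult.commute)
    then have "cell k u (r div (k + 1)) $ (r mod (k + 1)) = 0\<^sub>v (k + 1) $ (r mod (k + 1))"
      by (simp only: 0)
    moreover have "r mod (k + 1) < k + 1" by simp
    ultimately have "u $ r = 0"
      unfolding cell_def using div_mult_mod_eq[of r "k + 1"] by (simp del: div_mult_mod_eq)
    then show "u $ r = 0\<^sub>v ((k + 1) * Nx) $ r" using r by simp
  qed (use u in simp)
qed

text \<open>Reindexing along this shift is the summation by parts of the periodic mesh. The
  predecessor has the form \<open>i + N - 1\<close> because subtraction of naturals truncates; a
  left inverse gives injectivity, and finiteness then surjectivity.\<close>

lemma bij_betw_cyclic_Suc:
  fixes N :: nat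
  assumes "N > 0"
  shows "bij_betw (\<lambda>i. (i + 1) mod N) {..<N} {..<N}"
    and "\<And>i. i < N \<Longrightarrow> ((i + 1) mod N + N - 1) mod N = i"
proof -
  show inv: "((i + 1) mod N + N - 1) mod N = i" if "i < N" for i
  proof (cases "i + 1 = N")
    case True
    then have "(i + 1) mod N = 0" by simp
    then show ?thesis using True by auto
  next
    case False
    then have "(i + 1) mod N = i + 1" using that by simp
    then show ?thesis using that by simp
  qed
  have "inj_on (\<lambda>i. (i + 1) mod N) {..<N}"
    by (rule inj_on_inverseI[where g = "\<lambda>i. (i + N - 1) mod N"]) (rule inv, simp)
  moreover have "(\<lambda>i. (i + 1) mod N) ` {..<N} \<subseteq> {..<N}" using assms by auto
  ultimately show "bij_betw (\<lambda>i. (i + 1) mod N) {..<N} {..<N}"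
    by (simp add: bij_betw_def endo_inj_surj)
qed

text \<open>The mass matrix of the inner product cancels the inverse one in the DG matrix, and
  \<open>dx\<close> cancels \<open>1 / dx\<close>. What is left is the weak form, where skewness is
  visible on the blocks.\<close>

lemma dg_inner_dg_matrix:
  assumes w: "w \<in> carrier_vec ((k + 1) * Nx)" and "dx > 0"
  shows "dg_inner k Nx dx u (dg_matrix k Nx dx *\<^sub>v w) =
    (\<Sum>i<Nx. cell k u i \<bullet> (dg_D1 k *\<^sub>v cell k w i)
      + cell k u i \<bullet> (dg_D2 k *\<^sub>v cell k w ((i + 1) mod Nx))
      + cell k u i \<bullet> (dg_D3 k *\<^sub>v cell k w ((i + Nx - 1) mod Nx)))"
proof -
  let ?W = "mat_inv (dg_M k)" and ?d = "k + 1"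
  have "dx * (cell k u i \<bullet> (dg_M k *\<^sub>v cell k (dg_matrix k Nx dx *\<^sub>v w) i)) =
      cell k u i \<bullet> (dg_D1 k *\<^sub>v cell k w i)
      + cell k u i \<bullet> (dg_D2 k *\<^sub>v cell k w ((i + 1) mod Nx))
      + cell k u i \<bullet> (dg_D3 k *\<^sub>v cell k w ((i + Nx - 1) mod Nx))" if "i < Nx" for i
  proof -
    define a b c where "a = dg_D1 k *\<^sub>v cell k w i"
      and "b = dg_D2 k *\<^sub>v cell k w ((i + 1) mod Nx)"
      and "c = dg_D3 k *\<^sub>v cell k w ((i + Nx - 1) mod Nx)"
    have abc: "a \<in> carrier_vec ?d" "b \<in> carrier_vec ?d" "c \<in> carrier_vec ?d"
      unfolding a_def b_def c_def by (intro mult_mat_vec_carrier[OF _ cell_carrier] dg_carrier)+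
    have "dg_M k *\<^sub>v (?W *\<^sub>v (a + b + c)) = a + b + c"
      using abc dg_M_mat_inv[of k]
        assoc_mult_mat_vec[OF dg_carrier(1) dg_M_mat_inv(1), of "a + b + c" k] by simp
    then have "dg_M k *\<^sub>v cell k (dg_matrix k Nx dx *\<^sub>v w) i = (1 / dx) \<cdot>\<^sub>v (a + b + c)"
      unfolding cell_dg_matrix_mult_vec[OF dg_M_mat_inv(1) w that] a_def[symmetric] b_def[symmetric]
        c_def[symmetric]
      using abc mult_mat_vec_carrier[OF dg_M_mat_inv(1), of "a + b + c" k]
      by (simp add: mult_mat_vec[OF dg_carrier(1)])
    moreover have "cell k u i \<bullet> (a + b + c) = cell k u i \<bullet> a + cell k u i \<bullet> b + cell k u i \<bullet> c"
      using abc by (simp add: scalar_prod_add_distrib[of _ ?d])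
    ultimately show ?thesis
      using abc \<open>dx > 0\<close> unfolding a_def[symmetric] b_def[symmetric] c_def[symmetric]
      by (simp add: scalar_prod_smult_distrib[of _ ?d])
  qed
  then show ?thesis by (simp add: dg_inner_def sum_distrib_left)
qed

lemma dg_matrix_carrier: "dg_matrix k Nx dx \<in> carrier_mat ((k + 1) * Nx) ((k + 1) * Nx)"
  by (simp add: dg_matrix_def)

lemma dg_matrix_skew_adjoint:
  assumes u: "u \<in> carrier_vec ((k + 1) * Nx)" and w: "w \<in> carrier_vec ((k + 1) * Nx)"
    and "dx > 0"
  shows "dg_inner k Nx dx (dg_matrix k Nx dx *\<^sub>v u) w = - dg_inner k Nx dx u (dg_matrix k Nx dx *\<^sub>v w)"
proof (cases "Nx = 0")
  case True
  then show ?thesis by (simp add: dg_inner_def)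
next
  case False
  then have N: "Nx > 0" by simp
  define x y where "x = cell k u" and "y = cell k w"
  let ?s = "\<lambda>i. (i + 1) mod Nx" and ?p = "\<lambda>i. (i + Nx - 1) mod Nx"
  have xy: "x i \<in> carrier_vec (k + 1)" "y i \<in> carrier_vec (k + 1)" for i
    by (simp_all add: x_def y_def)
  have D1: "y i \<bullet> (dg_D1 k *\<^sub>v x i) = - (x i \<bullet> (dg_D1 k *\<^sub>v y i))" for i
    by (rule scalar_prod_transpose_eq_uminus[OF dg_carrier(2) transpose_dg(2) xy(2) xy(1)])
  \<comment> \<open>An interface is seen from its left cell through \<open>dg_D2\<close> and from
    its right cell through \<open>dg_D3\<close>; moving the summation index to the other side pairs
    the two with opposite signs. The neighbours need not be distinct, so meshes of one or two cells
    are included.\<close>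
  have shift: "(\<Sum>i<Nx. a i \<bullet> (dg_D2 k *\<^sub>v b (?s i))) = - (\<Sum>i<Nx. b i \<bullet> (dg_D3 k *\<^sub>v a (?p i)))"
    if ab: "\<And>i. a i \<in> carrier_vec (k + 1)" "\<And>i. b i \<in> carrier_vec (k + 1)" for a b
  proof -
    have "(\<Sum>i<Nx. a i \<bullet> (dg_D2 k *\<^sub>v b (?s i))) = (\<Sum>i<Nx. - (b (?s i) \<bullet> (dg_D3 k *\<^sub>v a (?p (?s i)))))"
    proof (intro sum.cong refl)
      fix i assume "i \<in> {..<Nx}"
      then have "?p (?s i) = i" using bij_betw_cyclic_Suc(2)[OF N] by simp
      then show "a i \<bullet> (dg_D2 k *\<^sub>v b (?s i)) = - (b (?s i) \<bullet> (dg_D3 k *\<^sub>v a (?p (?s i))))"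
        using scalar_prod_transpose_eq_uminus[OF dg_carrier(3) transpose_dg(3) ab(1) ab(2)] by simp
    qed
    also have "\<dots> = (\<Sum>i<Nx. - (b i \<bullet> (dg_D3 k *\<^sub>v a (?p i))))"
      by (rule sum.reindex_bij_betw[OF bij_betw_cyclic_Suc(1)[OF N]])
    finally show ?thesis by (simp add: sum_negf)
  qed
  show ?thesis
    unfolding dg_inner_commute[of k Nx dx _ w] dg_inner_dg_matrix[OF u \<open>dx > 0\<close>]
      dg_inner_dg_matrix[OF w \<open>dx > 0\<close>] x_def[symmetric] y_def[symmetric] sum.distrib
    using shift[of x y] shift[of y x] xy by (simp only: D1 sum_negf)
qed

section \<open>The kernel projection and the inverse of \<open>A + P\<close>\<close>

lemma dg_projection:
  assumes "dx > 0" and n: "n = (k + 1) * Nx" and Adef: "A = dg_matrix k Nx dx"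
    and P: "is_orthogonal_projection n (dg_inner k Nx dx) (mat_kernel A) P"
  shows "P \<in> carrier_mat n n" "A * P = 0\<^sub>m n n" "P * A = 0\<^sub>m n n" "P * P = P"
    and "\<And>u. u \<in> carrier_vec n \<Longrightarrow> A *\<^sub>v u = 0\<^sub>v n \<Longrightarrow> P *\<^sub>v u = u"
proof -
  let ?ip = "dg_inner k Nx dx"
  have A: "A \<in> carrier_mat n n" using dg_matrix_carrier n Adef by simp
  show Pc: "P \<in> carrier_mat n n" using P by (simp add: is_orthogonal_projection_def)
  have ker: "mat_kernel A = {v \<in> carrier_vec n. A *\<^sub>v v = 0\<^sub>v n}"
    using mat_kernel[OF A] by auto
  have APv: "A *\<^sub>v (P *\<^sub>v u) = 0\<^sub>v n" if "u \<in> carrier_vec n" for u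
    using P that ker by (auto simp: is_orthogonal_projection_def)
  have orth: "?ip (u - P *\<^sub>v u) w = 0" if "u \<in> carrier_vec n" "w \<in> carrier_vec n" "A *\<^sub>v w = 0\<^sub>v n" for u w
    using P that ker by (auto simp: is_orthogonal_projection_def)
  have zero: "?ip u (0\<^sub>v n) = 0" if "u \<in> carrier_vec n" for u
  proof -
    have "?ip (0\<^sub>v n - 0\<^sub>v n) u = 0"
      using dg_inner_minus_left[of "0\<^sub>v n" k Nx "0\<^sub>v n" dx u] n by simp
    then show ?thesis by (simp add: dg_inner_commute[of _ _ _ u])
  qed
  \<comment> \<open>For \<open>u\<close> in the kernel, \<open>u - P u\<close> is both in the kernel
    and orthogonal to it, hence zero by definiteness.\<close>
  show kerP: "P *\<^sub>v u = u" if u: "u \<in> carrier_vec n" "A *\<^sub>v u = 0\<^sub>v n" for u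
  proof -
    define w where "w = u - P *\<^sub>v u"
    have w: "w \<in> carrier_vec n" using u Pc by (simp add: w_def)
    have "A *\<^sub>v w = 0\<^sub>v n"
      using mult_minus_distrib_mat_vec[OF A u(1), of "P *\<^sub>v u"] u Pc APv by (simp add: w_def)
    then have "?ip w w = 0" using orth[OF u(1) w] by (simp add: w_def)
    then have 0: "w = 0\<^sub>v n" using dg_inner_definite[of w k Nx dx] w n \<open>dx > 0\<close> by simp
    show ?thesis
    proof (rule eq_vecI)
      fix i assume "i < dim_vec u"
      then show "(P *\<^sub>v u) $ i = u $ i"
        using arg_cong[OF 0, of "\<lambda>v. v $ i"] u Pc by (simp add: w_def)
    qed (use u Pc in simp)
  qed
  show "A * P = 0\<^sub>m n n"
    using A Pc APv by (intro eq_mat_if_eq_mult_vec[of _ n n]) auto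
  show "P * P = P"
    using A Pc APv kerP by (intro eq_mat_if_eq_mult_vec[of _ n n]) auto
  have "P *\<^sub>v (A *\<^sub>v u) = 0\<^sub>v n" if u: "u \<in> carrier_vec n" for u
  proof -
    \<comment> \<open>Split \<open>?ip w w\<close> into \<open>?ip (A u) w\<close> minus
      \<open>?ip (A u - w) w\<close>. The second term is zero by orthogonality; the first is
      \<open>- ?ip u (A w)\<close> by skew-adjointness, and \<open>A w = 0\<close>.\<close>
    define w where "w = P *\<^sub>v (A *\<^sub>v u)"
    have Au: "A *\<^sub>v u \<in> carrier_vec n" and w: "w \<in> carrier_vec n"
      using A Pc u by (auto simp: w_def)
    have Aw: "A *\<^sub>v w = 0\<^sub>v n" using APv[OF Au] by (simp add: w_def)
    have "?ip (A *\<^sub>v u - w) w = 0" using orth[OF Au w Aw] by (simp add: w_def)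
    moreover have "?ip (A *\<^sub>v u) w = 0"
      using dg_matrix_skew_adjoint[of u k Nx w dx] u w n \<open>dx > 0\<close> Aw zero Adef by simp
    ultimately have "?ip w w = 0"
      using dg_inner_minus_left[of "A *\<^sub>v u" k Nx w dx w] Au w n by simp
    then show ?thesis using dg_inner_definite[of w k Nx dx] w n \<open>dx > 0\<close> by (simp add: w_def)
  qed
  then show "P * A = 0\<^sub>m n n"
    using A Pc by (intro eq_mat_if_eq_mult_vec[of _ n n]) auto
qed

text \<open>Two products suffice. From \<open>P (A + P) = P\<close>, a vector killed by
  \<open>A + P\<close> is killed by \<open>P\<close>, then by \<open>A\<close>, and so equals its
  own projection, which is zero. From \<open>(A + P) (1 - P) = A\<close>, multiplication by the
  inverse gives \<open>1 - P\<close>. The inverse commutes with \<open>A\<close> because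
  \<open>A + P\<close> does.\<close>

lemma add_kernel_projection_inverse:
  assumes A: "A \<in> carrier_mat n n" and P: "P \<in> carrier_mat n n"
    and AP: "A * P = 0\<^sub>m n n" and PA: "P * A = 0\<^sub>m n n" and PP: "P * P = P"
    and kerP: "\<And>u. u \<in> carrier_vec n \<Longrightarrow> A *\<^sub>v u = 0\<^sub>v n \<Longrightarrow> P *\<^sub>v u = u"
  shows "invertible_mat (A + P)" "mat_inv (A + P) \<in> carrier_mat n n"
    "mat_inv (A + P) * A = 1\<^sub>m n - P" "A * mat_inv (A + P) = mat_inv (A + P) * A"
proof -
  define G where "G = mat_inv (A + P)"
  have S: "A + P \<in> carrier_mat n n" using P by simp
  have ker: "v = 0\<^sub>v n" if v: "v \<in> carrier_vec n" "(A + P) *\<^sub>v v = 0\<^sub>v n" for v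
  proof -
    have P0: "P *\<^sub>v 0\<^sub>v n = 0\<^sub>v n" using P by (intro eq_vecI) auto
    have "P * (A + P) = P" using A P PA PP by (simp add: mult_add_distrib_mat[OF P A P])
    moreover have "(P * (A + P)) *\<^sub>v v = 0\<^sub>v n"
      using P0 v(2) by (simp add: assoc_mult_mat_vec[OF P S v(1)])
    ultimately have Pv: "P *\<^sub>v v = 0\<^sub>v n" by simp
    then have "A *\<^sub>v v = 0\<^sub>v n"
      using v A by (simp add: add_mult_distrib_mat_vec[OF A P v(1)])
    then show ?thesis using kerP[OF v(1)] Pv by simp
  qed
  have G: "G \<in> carrier_mat n n" and SG: "(A + P) * G = 1\<^sub>m n" and GS: "G * (A + P) = 1\<^sub>m n"
    unfolding G_def using mat_inv_if_trivial_kernel[OF S ker] by auto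
  show "mat_inv (A + P) \<in> carrier_mat n n" using G by (simp add: G_def)
  show "invertible_mat (A + P)"
    unfolding invertible_mat_def inverts_mat_def
    using S G SG GS carrier_matD[OF S] carrier_matD[OF G] by (intro conjI exI[of _ G]) auto
  have Q: "1\<^sub>m n - P \<in> carrier_mat n n" by (rule minus_carrier_mat[OF P])
  have GA: "G * A \<in> carrier_mat n n" and AS: "A * (A + P) \<in> carrier_mat n n"
    using G A S by auto
  have "A * (1\<^sub>m n - P) = A"
    using mult_minus_distrib_mat[OF A one_carrier_mat P] A AP by (auto intro: eq_matI)
  moreover have "P * (1\<^sub>m n - P) = 0\<^sub>m n n"
    using mult_minus_distrib_mat[OF P one_carrier_mat P] P PP by simp
  ultimately have SQ: "(A + P) * (1\<^sub>m n - P) = A"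
    using add_mult_distrib_mat[OF A P Q] right_add_zero_mat[OF A] by simp
  have "G * A = G * ((A + P) * (1\<^sub>m n - P))" by (simp only: SQ)
  also have "\<dots> = 1\<^sub>m n - P"
    unfolding assoc_mult_mat[OF G S Q, symmetric] GS by (rule left_mult_one_mat[OF Q])
  finally show "mat_inv (A + P) * A = 1\<^sub>m n - P" by (simp only: G_def)
  have AS_eq: "A * (A + P) = (A + P) * A"
    by (simp only: mult_add_distrib_mat[OF A A P] add_mult_distrib_mat[OF A P A] AP PA)
  have "G * A = (G * A) * ((A + P) * G)" unfolding SG by (rule right_mult_one_mat[OF GA, symmetric])
  also have "\<dots> = (G * (A * (A + P))) * G"
    unfolding assoc_mult_mat[OF GA S G, symmetric] assoc_mult_mat[OF G A S] ..
  also have "\<dots> = A * G"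
    unfolding AS_eq assoc_mult_mat[OF G S A, symmetric] GS left_mult_one_mat[OF A] ..
  finally show "A * mat_inv (A + P) = mat_inv (A + P) * A" by (simp only: G_def)
qed

section \<open>Exponential series of matrices\<close>

text \<open>An entry of a product is a sum of \<open>n\<close> terms, so each further factor costs
  at most \<open>n * K\<close>.\<close>

lemma abs_pow_mat_index_le:
  fixes X :: "real mat"
  assumes X: "X \<in> carrier_mat n n"
    and K: "\<And>i j. i < n \<Longrightarrow> j < n \<Longrightarrow> \<bar>X $$ (i, j)\<bar> \<le> K" and "K \<ge> 0"
    and "i < n" "j < n"
  shows "\<bar>(X ^\<^sub>m m) $$ (i, j)\<bar> \<le> (real n * K) ^ m"
  using \<open>j < n\<close>
proof (induction m arbitrary: j)
  case 0
  then show ?case using X \<open>i < n\<close> by simp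
next
  case (Suc m)
  have "\<bar>(X ^\<^sub>m Suc m) $$ (i, j)\<bar> = \<bar>\<Sum>l<n. (X ^\<^sub>m m) $$ (i, l) * X $$ (l, j)\<bar>"
    using X \<open>i < n\<close> Suc.prems
    by (simp add: scalar_prod_def lessThan_atLeast0)
  also have "\<dots> \<le> (\<Sum>l<n. \<bar>(X ^\<^sub>m m) $$ (i, l) * X $$ (l, j)\<bar>)"
    by (rule sum_abs)
  also have "\<dots> \<le> (\<Sum>l<n. (real n * K) ^ m * K)"
  proof (rule sum_mono)
    fix l assume "l \<in> {..<n}"
    then show "\<bar>(X ^\<^sub>m m) $$ (i, l) * X $$ (l, j)\<bar> \<le> (real n * K) ^ m * K"
      unfolding abs_mult using Suc K \<open>K \<ge> 0\<close> by (intro mult_mono) auto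
  qed
  also have "\<dots> = (real n * K) ^ Suc m" by simp
  finally show ?case .
qed

lemma summable_mat_exp:
  fixes X :: "real mat"
  assumes X: "X \<in> carrier_mat n n" and "i < n" "j < n"
  shows "summable (\<lambda>m. (X ^\<^sub>m m) $$ (i, j) / fact m)"
proof -
  \<comment> \<open>The sum of all absolute entries is a convenient bound for each of them; the
    comparison series is that of exp(n K).\<close>
  define K where "K = (\<Sum>i<n. \<Sum>j<n. \<bar>X $$ (i, j)\<bar>)"
  have K: "\<bar>X $$ (i, j)\<bar> \<le> K" if "i < n" "j < n" for i j
  proof -
    have "\<bar>X $$ (i, j)\<bar> \<le> (\<Sum>j<n. \<bar>X $$ (i, j)\<bar>)"
      using that by (intro member_le_sum[of j]) auto
    also have "\<dots> \<le> K"
      unfolding K_def using that by (intro member_le_sum[of i]) (auto intro: sum_nonneg)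
    finally show ?thesis .
  qed
  have "K \<ge> 0" unfolding K_def by (intro sum_nonneg) auto
  show ?thesis
  proof (rule summable_comparison_test')
    show "summable (\<lambda>m. (real n * K) ^ m / fact m)"
      using summable_exp[of "real n * K"] by (simp add: field_simps)
    show "norm ((X ^\<^sub>m m) $$ (i, j) / fact m) \<le> (real n * K) ^ m / fact m" for m
      using abs_pow_mat_index_le[OF X K \<open>K \<ge> 0\<close> assms(2,3), of m]
      by (simp add: divide_right_mono)
  qed
qed

text \<open>The vectors \<open>y m\<close> are the exponential Taylor coefficients of \<open>s\<close>: \<open>s = (\<Sum>m. y m / m!)\<close>.\<close>

definition exp_sums :: "nat \<Rightarrow> (nat \<Rightarrow> real vec) \<Rightarrow> real vec \<Rightarrow> bool" where
  "exp_sums n y s \<longleftrightarrow> s \<in> carrier_vec n \<and> (\<forall>m. y m \<in> carrier_vec n) \<and>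
     (\<forall>i<n. (\<lambda>m. y m $ i / fact m) sums (s $ i))"

lemma exp_sumsI:
  assumes "s \<in> carrier_vec n" "\<And>m. y m \<in> carrier_vec n"
    and "\<And>i. i < n \<Longrightarrow> (\<lambda>m. y m $ i / fact m) sums (s $ i)"
  shows "exp_sums n y s"
  unfolding exp_sums_def using assms by blast

lemma exp_sumsD: "exp_sums n y s \<Longrightarrow> i < n \<Longrightarrow> (\<lambda>m. y m $ i / fact m) sums (s $ i)"
  unfolding exp_sums_def by blast

lemma exp_sums_carrier:
  assumes "exp_sums n y s"
  shows "s \<in> carrier_vec n" "y m \<in> carrier_vec n"
  using assms unfolding exp_sums_def by blast+

lemma exp_sums_unique:
  assumes s: "exp_sums n y s" and t: "exp_sums n y t"
  shows "s = t"
proof (rule eq_vecI)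
  show "dim_vec s = dim_vec t"
    by (simp only: carrier_vecD[OF exp_sums_carrier(1)[OF s]] carrier_vecD[OF exp_sums_carrier(1)[OF t]])
  fix i assume "i < dim_vec t"
  then have i: "i < n" unfolding carrier_vecD[OF exp_sums_carrier(1)[OF t]] .
  from exp_sumsD[OF s i] exp_sumsD[OF t i] show "s $ i = t $ i" by (rule sums_unique2)
qed

lemma exp_sums_add:
  assumes s: "exp_sums n y s" and t: "exp_sums n z t"
  shows "exp_sums n (\<lambda>m. y m + z m) (s + t)"
proof (rule exp_sumsI)
  fix i assume i: "i < n"
  have "(u + v) $ i = u $ i + v $ i" if "v \<in> carrier_vec n" for u v :: "real vec"
    using that i by simp
  then show "(\<lambda>m. (y m + z m) $ i / fact m) sums ((s + t) $ i)"
    using sums_add[OF exp_sumsD[OF s i] exp_sumsD[OF t i]] exp_sums_carrier[OF t]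
    by (simp only: add_divide_distrib)
qed (intro add_carrier_vec exp_sums_carrier[OF s] exp_sums_carrier[OF t])+

lemma exp_sums_minus:
  assumes s: "exp_sums n y s" and t: "exp_sums n z t"
  shows "exp_sums n (\<lambda>m. y m - z m) (s - t)"
proof (rule exp_sumsI)
  fix i assume i: "i < n"
  have "(u - v) $ i = u $ i - v $ i" if "v \<in> carrier_vec n" for u v :: "real vec"
    using that i by simp
  then show "(\<lambda>m. (y m - z m) $ i / fact m) sums ((s - t) $ i)"
    using sums_diff[OF exp_sumsD[OF s i] exp_sumsD[OF t i]] exp_sums_carrier[OF t]
    by (simp only: diff_divide_distrib)
qed (intro minus_carrier_vec exp_sums_carrier[OF s] exp_sums_carrier[OF t])+

lemma exp_sums_smult:
  assumes s: "exp_sums n y s"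
  shows "exp_sums n (\<lambda>m. c \<cdot>\<^sub>v y m) (c \<cdot>\<^sub>v s)"
proof (rule exp_sumsI)
  fix i assume i: "i < n"
  have "(c \<cdot>\<^sub>v u) $ i = c * u $ i" if "u \<in> carrier_vec n" for u
    using that i by simp
  then show "(\<lambda>m. (c \<cdot>\<^sub>v y m) $ i / fact m) sums ((c \<cdot>\<^sub>v s) $ i)"
    using sums_mult[OF exp_sumsD[OF s i], of c] exp_sums_carrier[OF s]
    by (simp only: times_divide_eq_right)
qed (simp_all only: smult_carrier_vec exp_sums_carrier[OF s])

lemma exp_sums_mult_mat_vec:
  assumes "exp_sums n y s" and "X \<in> carrier_mat r n"
  shows "exp_sums r (\<lambda>m. X *\<^sub>v y m) (X *\<^sub>v s)"
proof -
  have "(\<lambda>m. (X *\<^sub>v y m) $ i / fact m) sums ((X *\<^sub>v s) $ i)" if "i < r" for i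
  proof -
    have "(\<lambda>m. \<Sum>j<n. X $$ (i, j) * (y m $ j / fact m)) sums (\<Sum>j<n. X $$ (i, j) * s $ j)"
      by (intro sums_sum sums_mult exp_sumsD[OF assms(1)]) simp
    moreover have "(X *\<^sub>v u) $ i = (\<Sum>j<n. X $$ (i, j) * u $ j)" if "u \<in> carrier_vec n" for u
      using that assms(2) \<open>i < r\<close> by (simp add: scalar_prod_def lessThan_atLeast0)
    ultimately show ?thesis
      by (simp only: exp_sums_carrier[OF assms(1)] sum_divide_distrib times_divide_eq_right)
  qed
  then show ?thesis
    by (intro exp_sumsI mult_mat_vec_carrier[OF assms(2)] exp_sums_carrier[OF assms(1)])
qed

lemma exp_sums_finsum_vec:
  assumes "finite I" and "\<And>x. x \<in> I \<Longrightarrow> exp_sums n (\<lambda>m. y m x) (s x)"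
  shows "exp_sums n (\<lambda>m. finsum_vec TYPE(real) n (y m) I) (finsum_vec TYPE(real) n s I)"
proof -
  have c: "y m \<in> I \<rightarrow> carrier_vec n" "s \<in> I \<rightarrow> carrier_vec n" for m
    using exp_sums_carrier[OF assms(2)] by blast+
  have "(\<lambda>m. finsum_vec TYPE(real) n (y m) I $ i / fact m) sums (finsum_vec TYPE(real) n s I $ i)"
    if "i < n" for i
    unfolding index_finsum_vec[OF assms(1) that c(1)] index_finsum_vec[OF assms(1) that c(2)]
      sum_divide_distrib
    by (intro sums_sum exp_sumsD[OF assms(2) that])
  then show ?thesis
    by (intro exp_sumsI finsum_vec_closed c)
qed

text \<open>The coefficient sequence of a constant, in the same scalar-times-vector shape as the
  other series.\<close>

lemma exp_sums_const:
  assumes "u \<in> carrier_vec n"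
  shows "exp_sums n (\<lambda>m. (if m = 0 then 1 else 0) \<cdot>\<^sub>v u) u"
proof -
  have "(\<lambda>m. (if m = 0 then 1 else 0) * c / fact m) sums c" for c :: real
    using sums_single[of 0 "\<lambda>_. c"] by (rule back_subst[of "\<lambda>h. h sums c"]) auto
  then show ?thesis
    using carrier_vecD[OF assms] assms by (intro exp_sumsI) simp_all
qed

lemma smult_pow_mat:
  fixes X :: "'a :: comm_ring_1 mat"
  assumes X: "X \<in> carrier_mat n n"
  shows "(c \<cdot>\<^sub>m X) ^\<^sub>m m = c ^ m \<cdot>\<^sub>m X ^\<^sub>m m"
proof (induction m)
  case 0
  show ?case using X by auto
next
  case (Suc m)
  have p: "X ^\<^sub>m m \<in> carrier_mat n n" using X by simp
  show ?case
    using X by (intro eq_matI)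
      (auto simp: Suc mult_smult_assoc_mat[OF p] mult_smult_distrib[OF p X] mult_ac)
qed

text \<open>The scalar is kept outside the matrix power: exponentials of different multiples of
  \<open>X\<close> then become series over the same vectors \<open>X ^\<^sub>m m *\<^sub>v u\<close>
  and can be combined through their scalar coefficients alone.\<close>

lemma exp_sums_mat_exp:
  fixes X :: "real mat"
  assumes X: "X \<in> carrier_mat n n" and u: "u \<in> carrier_vec n"
  shows "exp_sums n (\<lambda>m. c ^ m \<cdot>\<^sub>v (X ^\<^sub>m m *\<^sub>v u)) (mat_exp (c \<cdot>\<^sub>m X) *\<^sub>v u)"
proof -
  define Y where "Y = c \<cdot>\<^sub>m X"
  have Y: "Y \<in> carrier_mat n n" using X by (simp add: Y_def)
  have e: "mat_exp Y \<in> carrier_mat n n" using Y by (simp add: mat_exp_def)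
  have mv: "(Z *\<^sub>v u) $ i = (\<Sum>j<n. Z $$ (i, j) * u $ j)" if "Z \<in> carrier_mat n n" "i < n" for Z i
    using that u by (simp add: scalar_prod_def lessThan_atLeast0)
  have p: "Y ^\<^sub>m m \<in> carrier_mat n n" for m using Y by simp
  have "exp_sums n (\<lambda>m. Y ^\<^sub>m m *\<^sub>v u) (mat_exp Y *\<^sub>v u)"
  proof (rule exp_sumsI)
    fix i assume i: "i < n"
    have "(\<lambda>m. \<Sum>j<n. (Y ^\<^sub>m m) $$ (i, j) / fact m * u $ j) sums (\<Sum>j<n. mat_exp Y $$ (i, j) * u $ j)"
    proof (intro sums_sum sums_mult2)
      fix j assume "j \<in> {..<n}"
      then show "(\<lambda>m. (Y ^\<^sub>m m) $$ (i, j) / fact m) sums (mat_exp Y $$ (i, j))"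
        using summable_mat_exp[OF Y i, of j] Y i by (simp add: mat_exp_def summable_sums)
    qed
    then show "(\<lambda>m. (Y ^\<^sub>m m *\<^sub>v u) $ i / fact m) sums (mat_exp Y *\<^sub>v u) $ i"
      unfolding mv[OF p i] mv[OF e i] by (simp add: sum_divide_distrib)
  qed (rule mult_mat_vec_carrier[OF e u] mult_mat_vec_carrier[OF p u])+
  moreover have "Y ^\<^sub>m m *\<^sub>v u = c ^ m \<cdot>\<^sub>v (X ^\<^sub>m m *\<^sub>v u)" for m
  proof -
    have "X ^\<^sub>m m \<in> carrier_mat n n" using X by simp
    then show ?thesis
      unfolding Y_def smult_pow_mat[OF X] using u by (intro eq_vecI) auto
  qed
  ultimately show ?thesis by (simp add: Y_def)
qed

section \<open>Series of state vectors, block by block\<close>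

lemma state_carrier: "state n Nv1 Nv2 f B E2 E1 \<in> carrier_vec (state_dim n Nv1 Nv2)"
  by (simp add: state_def)

text \<open>The existence of an index forces \<open>n > 0\<close>, and that of a distribution block
  forces \<open>Nv2 > 0\<close>, so the remainders are true positions. Blocks count from 0 and
  velocities from 1, hence the shifts.\<close>

lemma state_block_index:
  assumes "r < state_dim n Nv1 Nv2"
  shows "r mod n < n"
    and "r div n < Nv1 * Nv2 \<Longrightarrow> r div n div Nv2 + 1 \<in> {1..Nv1}"
    and "r div n < Nv1 * Nv2 \<Longrightarrow> r div n mod Nv2 + 1 \<in> {1..Nv2}"
proof -
  show "r mod n < n" using assms by (cases "n = 0") (auto simp: state_dim_def)
  assume b: "r div n < Nv1 * Nv2"
  then show "r div n div Nv2 + 1 \<in> {1..Nv1}" by (simp add: less_mult_imp_div_less Suc_le_eq)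
  have "Nv2 > 0" using b by (cases "Nv2 = 0") auto
  then show "r div n mod Nv2 + 1 \<in> {1..Nv2}" by (simp add: Suc_le_eq)
qed

lemma exp_sums_state:
  assumes f: "\<And>j1 j2. j1 \<in> {1..Nv1} \<Longrightarrow> j2 \<in> {1..Nv2} \<Longrightarrow> exp_sums n (\<lambda>m. g m j1 j2) (f j1 j2)"
    and b: "exp_sums n b B" and e2: "exp_sums n e2 E2" and e1: "exp_sums n e1 E1"
  shows "exp_sums (state_dim n Nv1 Nv2) (\<lambda>m. state n Nv1 Nv2 (g m) (b m) (e2 m) (e1 m))
    (state n Nv1 Nv2 f B E2 E1)"
proof (rule exp_sumsI)
  fix r assume r: "r < state_dim n Nv1 Nv2"
  note s = state_block_index(1)[OF r] and j = state_block_index(2,3)[OF r]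
  show "(\<lambda>m. state n Nv1 Nv2 (g m) (b m) (e2 m) (e1 m) $ r / fact m) sums state n Nv1 Nv2 f B E2 E1 $ r"
    using exp_sumsD[OF f[OF j] s] exp_sumsD[OF b s] exp_sumsD[OF e2 s] exp_sumsD[OF e1 s] r
    by (auto simp: state_def Let_def)
qed (rule state_carrier)+

section \<open>The exponential of the block system\<close>

lemma smult_mat_mult_vec:
  fixes M :: "'a :: comm_ring_1 mat"
  assumes "M \<in> carrier_mat r n" "u \<in> carrier_vec n"
  shows "(c \<cdot>\<^sub>m M) *\<^sub>v u = c \<cdot>\<^sub>v (M *\<^sub>v u)"
  using assms by (intro eq_vecI) auto

text \<open>Powers are built by appending a factor on the right, whereas the recursions below apply
  the matrix from the left.\<close>

lemma mult_pow_mat_commute: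
  fixes X :: "'a :: comm_ring_1 mat"
  assumes X: "X \<in> carrier_mat n n"
  shows "X * X ^\<^sub>m m = X ^\<^sub>m m * X"
proof (induction m)
  case 0
  then show ?case using X by simp
next
  case (Suc m)
  have p: "X ^\<^sub>m m \<in> carrier_mat n n" using X by simp
  show ?case using Suc by (simp flip: assoc_mult_mat[OF X p X])
qed

lemma mult_mat_finsum_vec:
  fixes X :: "'a :: comm_ring_1 mat"
  assumes X: "X \<in> carrier_mat r n" and "finite I" and g: "g \<in> I \<rightarrow> carrier_vec n"
  shows "X *\<^sub>v finsum_vec TYPE('a) n g I = finsum_vec TYPE('a) r (\<lambda>x. X *\<^sub>v g x) I"
  using \<open>finite I\<close> g
proof (induction I)
  case empty
  show ?case using X by (intro eq_vecI) (auto simp: finsum_vec_empty)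
next
  case (insert x I)
  have g: "g \<in> I \<rightarrow> carrier_vec n" "g x \<in> carrier_vec n" using insert.prems by auto
  have Xg: "(\<lambda>x. X *\<^sub>v g x) \<in> I \<rightarrow> carrier_vec r" "X *\<^sub>v g x \<in> carrier_vec r"
    using g mult_mat_vec_carrier[OF X] by auto
  show ?case
    unfolding finsum_vec_insert[OF insert.hyps g] finsum_vec_insert[OF insert.hyps Xg]
    using insert.IH[OF g(1)] mult_add_distrib_mat_vec[OF X g(2) finsum_vec_closed[OF g(1)]] by simp
qed

lemma finsum_vec_cong:
  fixes g h :: "'c \<Rightarrow> 'a :: comm_monoid_add vec"
  assumes "finite I" "h \<in> I \<rightarrow> carrier_vec n" and "\<And>x. x \<in> I \<Longrightarrow> g x = h x"
  shows "finsum_vec TYPE('a) n g I = finsum_vec TYPE('a) n h I"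
proof -
  have g: "g \<in> I \<rightarrow> carrier_vec n" using assms(2,3) by auto
  show ?thesis
    using assms finsum_vec_closed[OF g] finsum_vec_closed[OF assms(2)]
    by (intro eq_vecI) (simp_all add: index_finsum_vec[OF _ _ g] index_finsum_vec[OF _ _ assms(2)])
qed

lemma vel_sum_cong:
  assumes "\<And>j1 j2. j1 \<in> {1..Nv1} \<Longrightarrow> j2 \<in> {1..Nv2} \<Longrightarrow> h j1 j2 \<in> carrier_vec n"
    and "\<And>j1 j2. j1 \<in> {1..Nv1} \<Longrightarrow> j2 \<in> {1..Nv2} \<Longrightarrow> g j1 j2 = h j1 j2"
  shows "vel_sum n Nv1 Nv2 g = vel_sum n Nv1 Nv2 h"
  using assms by (intro finsum_vec_cong) auto

lemma vel_sum_carrier: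
  assumes "\<And>j1 j2. j1 \<in> {1..Nv1} \<Longrightarrow> j2 \<in> {1..Nv2} \<Longrightarrow> h j1 j2 \<in> carrier_vec n"
  shows "vel_sum n Nv1 Nv2 h \<in> carrier_vec n"
  using assms by (intro finsum_vec_closed) auto

lemma mult_mat_vel_sum:
  assumes X: "X \<in> carrier_mat n n"
    and h: "\<And>j1 j2. j1 \<in> {1..Nv1} \<Longrightarrow> j2 \<in> {1..Nv2} \<Longrightarrow> h j1 j2 \<in> carrier_vec n"
  shows "X *\<^sub>v vel_sum n Nv1 Nv2 h = vel_sum n Nv1 Nv2 (\<lambda>j1 j2. X *\<^sub>v h j1 j2)"
  using h by (subst mult_mat_finsum_vec[OF X]) (auto simp: prod.case_distrib)

lemma vel_sum_index:
  assumes "\<And>j1 j2. j1 \<in> {1..Nv1} \<Longrightarrow> j2 \<in> {1..Nv2} \<Longrightarrow> h j1 j2 \<in> carrier_vec n" and "i < n"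
  shows "vel_sum n Nv1 Nv2 h $ i = (\<Sum>j1 = 1..Nv1. \<Sum>j2 = 1..Nv2. h j1 j2 $ i)"
proof -
  have "vel_sum n Nv1 Nv2 h $ i = (\<Sum>x \<in> {1..Nv1} \<times> {1..Nv2}. (case x of (j1, j2) \<Rightarrow> h j1 j2) $ i)"
    using assms by (intro index_finsum_vec) auto
  then show ?thesis by (simp add: sum.cartesian_product case_prod_beta)
qed

lemma vel_sum_diff:
  assumes "\<And>j1 j2. j1 \<in> {1..Nv1} \<Longrightarrow> j2 \<in> {1..Nv2} \<Longrightarrow> g j1 j2 \<in> carrier_vec n"
    and "\<And>j1 j2. j1 \<in> {1..Nv1} \<Longrightarrow> j2 \<in> {1..Nv2} \<Longrightarrow> h j1 j2 \<in> carrier_vec n"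
  shows "vel_sum n Nv1 Nv2 (\<lambda>j1 j2. g j1 j2 - h j1 j2) = vel_sum n Nv1 Nv2 g - vel_sum n Nv1 Nv2 h"
proof (rule eq_vecI)
  have c: "g j1 j2 - h j1 j2 \<in> carrier_vec n" if "j1 \<in> {1..Nv1}" "j2 \<in> {1..Nv2}" for j1 j2
    using assms that by auto
  have cs: "vel_sum n Nv1 Nv2 g \<in> carrier_vec n" "vel_sum n Nv1 Nv2 h \<in> carrier_vec n"
    "vel_sum n Nv1 Nv2 (\<lambda>j1 j2. g j1 j2 - h j1 j2) \<in> carrier_vec n"
    by (rule vel_sum_carrier, erule (1) assms c)+
  then show "dim_vec (vel_sum n Nv1 Nv2 (\<lambda>j1 j2. g j1 j2 - h j1 j2)) =
      dim_vec (vel_sum n Nv1 Nv2 g - vel_sum n Nv1 Nv2 h)" by simp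
  fix i assume "i < dim_vec (vel_sum n Nv1 Nv2 g - vel_sum n Nv1 Nv2 h)"
  then have ih: "i < dim_vec (vel_sum n Nv1 Nv2 h)" by (simp only: index_minus_vec)
  then have i: "i < n" unfolding carrier_vecD[OF cs(2)] .
  have "(\<Sum>j1 = 1..Nv1. \<Sum>j2 = 1..Nv2. (g j1 j2 - h j1 j2) $ i) =
      (\<Sum>j1 = 1..Nv1. \<Sum>j2 = 1..Nv2. g j1 j2 $ i - h j1 j2 $ i)"
    using assms(2)[THEN carrier_vecD] i by (intro sum.cong refl index_minus_vec) simp
  moreover have "vel_sum n Nv1 Nv2 g $ i = (\<Sum>j1 = 1..Nv1. \<Sum>j2 = 1..Nv2. g j1 j2 $ i)"
    "vel_sum n Nv1 Nv2 h $ i = (\<Sum>j1 = 1..Nv1. \<Sum>j2 = 1..Nv2. h j1 j2 $ i)"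
    "vel_sum n Nv1 Nv2 (\<lambda>j1 j2. g j1 j2 - h j1 j2) $ i =
      (\<Sum>j1 = 1..Nv1. \<Sum>j2 = 1..Nv2. (g j1 j2 - h j1 j2) $ i)"
    by (rule vel_sum_index[OF _ i], erule (1) assms c)+
  ultimately show "vel_sum n Nv1 Nv2 (\<lambda>j1 j2. g j1 j2 - h j1 j2) $ i =
      (vel_sum n Nv1 Nv2 g - vel_sum n Nv1 Nv2 h) $ i"
    unfolding index_minus_vec(1)[OF ih] by (simp only: sum_subtractf)
qed

lemma vel_sum_smult:
  assumes h: "\<And>j1 j2. j1 \<in> {1..Nv1} \<Longrightarrow> j2 \<in> {1..Nv2} \<Longrightarrow> h j1 j2 \<in> carrier_vec n"
  shows "vel_sum n Nv1 Nv2 (\<lambda>j1 j2. c \<cdot>\<^sub>v h j1 j2) = c \<cdot>\<^sub>v vel_sum n Nv1 Nv2 h"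
proof -
  \<comment> \<open>Scaling is multiplication by a scalar matrix, so linearity of matrices over
    \<open>vel_sum\<close> applies.\<close>
  have 1: "(c \<cdot>\<^sub>m 1\<^sub>m n) *\<^sub>v u = c \<cdot>\<^sub>v u" if "u \<in> carrier_vec n" for u
    using that by (simp add: smult_mat_mult_vec[of _ n n])
  have "(c \<cdot>\<^sub>m 1\<^sub>m n) *\<^sub>v vel_sum n Nv1 Nv2 h = vel_sum n Nv1 Nv2 (\<lambda>j1 j2. (c \<cdot>\<^sub>m 1\<^sub>m n) *\<^sub>v h j1 j2)"
    using h by (intro mult_mat_vel_sum) auto
  also have "\<dots> = vel_sum n Nv1 Nv2 (\<lambda>j1 j2. c \<cdot>\<^sub>v h j1 j2)"
    using h by (intro vel_sum_cong) (auto simp: 1)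
  finally show ?thesis using 1[OF vel_sum_carrier[of Nv1 Nv2 h n, OF h]] by simp
qed

lemma exp_sums_vel_sum:
  assumes "\<And>j1 j2. j1 \<in> {1..Nv1} \<Longrightarrow> j2 \<in> {1..Nv2} \<Longrightarrow> exp_sums n (\<lambda>m. y m j1 j2) (s j1 j2)"
  shows "exp_sums n (\<lambda>m. vel_sum n Nv1 Nv2 (y m)) (vel_sum n Nv1 Nv2 s)"
  using assms by (intro exp_sums_finsum_vec) auto

text \<open>A state reads its distribution blocks only on the velocity grid; this permits rewriting
  with facts, such as carrier membership, that hold only there.\<close>

lemma state_cong:
  assumes "\<And>j1 j2. j1 \<in> {1..Nv1} \<Longrightarrow> j2 \<in> {1..Nv2} \<Longrightarrow> f j1 j2 = g j1 j2"
    and "B = B'" "E2 = E2'" "E1 = E1'"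
  shows "state n Nv1 Nv2 f B E2 E1 = state n Nv1 Nv2 g B' E2' E1'"
proof (rule eq_vecI)
  fix r assume "r < dim_vec (state n Nv1 Nv2 g B' E2' E1')"
  then have "r < state_dim n Nv1 Nv2" by (simp add: state_def)
  then show "state n Nv1 Nv2 f B E2 E1 $ r = state n Nv1 Nv2 g B' E2' E1' $ r"
    using assms(2-) assms(1)[OF state_block_index(2,3)] by (simp add: state_def Let_def)
qed (simp add: state_def)

lemma smult_state:
  assumes "\<And>j1 j2. j1 \<in> {1..Nv1} \<Longrightarrow> j2 \<in> {1..Nv2} \<Longrightarrow> f j1 j2 \<in> carrier_vec n"
    and "B \<in> carrier_vec n" "E2 \<in> carrier_vec n" "E1 \<in> carrier_vec n"
  shows "c \<cdot>\<^sub>v state n Nv1 Nv2 f B E2 E1 =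
    state n Nv1 Nv2 (\<lambda>j1 j2. c \<cdot>\<^sub>v f j1 j2) (c \<cdot>\<^sub>v B) (c \<cdot>\<^sub>v E2) (c \<cdot>\<^sub>v E1)"
proof (rule eq_vecI)
  fix r assume "r < dim_vec (state n Nv1 Nv2 (\<lambda>j1 j2. c \<cdot>\<^sub>v f j1 j2) (c \<cdot>\<^sub>v B) (c \<cdot>\<^sub>v E2) (c \<cdot>\<^sub>v E1))"
  then have r: "r < state_dim n Nv1 Nv2" by (simp add: state_def)
  then show "(c \<cdot>\<^sub>v state n Nv1 Nv2 f B E2 E1) $ r =
      state n Nv1 Nv2 (\<lambda>j1 j2. c \<cdot>\<^sub>v f j1 j2) (c \<cdot>\<^sub>v B) (c \<cdot>\<^sub>v E2) (c \<cdot>\<^sub>v E1) $ r"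
    using assms(2-) assms(1)[OF state_block_index(2,3)[OF r]] state_block_index(1)[OF r]
    by (auto simp: state_def Let_def)
qed (simp add: state_def)

text \<open>
  Here \<open>X\<close> and \<open>L\<close> play the roles of \<open>dt A\<close> and \<open>dt L\<close>, and \<open>G\<close> that of \<open>(A + P)\<^sup>-\<^sup>1\<close>; since
  \<open>1 - P = G A\<close>, the projection is absorbed into \<open>G X\<close>.
\<close>

lemma mat_exp_state:
  fixes X G L :: "real mat" and v1 v2 :: "nat \<Rightarrow> real" and c :: real
  assumes X: "X \<in> carrier_mat n n" and G: "G \<in> carrier_mat n n" and GX: "X * G = G * X"
    and L: "L \<in> carrier_mat (state_dim n Nv1 Nv2) (state_dim n Nv1 Nv2)"
    and L_action: "\<And>g B E2 E1.
      (\<And>j1 j2. j1 \<in> {1..Nv1} \<Longrightarrow> j2 \<in> {1..Nv2} \<Longrightarrow> g j1 j2 \<in> carrier_vec n) \<Longrightarrow>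
      B \<in> carrier_vec n \<Longrightarrow> E2 \<in> carrier_vec n \<Longrightarrow> E1 \<in> carrier_vec n \<Longrightarrow>
      L *\<^sub>v state n Nv1 Nv2 g B E2 E1 = state n Nv1 Nv2
        (\<lambda>j1 j2. v1 j1 \<cdot>\<^sub>v (X *\<^sub>v g j1 j2))
        (X *\<^sub>v E2)
        (X *\<^sub>v B - c \<cdot>\<^sub>v vel_sum n Nv1 Nv2 (\<lambda>j1 j2. v2 j2 \<cdot>\<^sub>v (G *\<^sub>v (X *\<^sub>v g j1 j2))))
        (- (c \<cdot>\<^sub>v vel_sum n Nv1 Nv2 (\<lambda>j1 j2. v1 j1 \<cdot>\<^sub>v (G *\<^sub>v (X *\<^sub>v g j1 j2)))))"
    and nonresonant: "\<And>j. j \<in> {1..Nv1} \<Longrightarrow> v1 j \<noteq> 1 \<and> v1 j \<noteq> -1"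
    and \<alpha>: "\<And>j. j \<in> {1..Nv1} \<Longrightarrow> \<alpha> j =
        (- 1 / (2 * (1 - v1 j))) \<cdot>\<^sub>m mat_exp (1 \<cdot>\<^sub>m X)
        - (1 / (2 * (1 + v1 j))) \<cdot>\<^sub>m mat_exp ((- 1) \<cdot>\<^sub>m X)
        + (1 / (1 - (v1 j)\<^sup>2)) \<cdot>\<^sub>m mat_exp (v1 j \<cdot>\<^sub>m X)"
    and \<beta>: "\<And>j. j \<in> {1..Nv1} \<Longrightarrow> \<beta> j =
        (- 1 / (2 * (1 - v1 j))) \<cdot>\<^sub>m mat_exp (1 \<cdot>\<^sub>m X)
        + (1 / (2 * (1 + v1 j))) \<cdot>\<^sub>m mat_exp ((- 1) \<cdot>\<^sub>m X)
        + (v1 j / (1 - (v1 j)\<^sup>2)) \<cdot>\<^sub>m mat_exp (v1 j \<cdot>\<^sub>m X)"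
    and f: "\<And>j1 j2. j1 \<in> {1..Nv1} \<Longrightarrow> j2 \<in> {1..Nv2} \<Longrightarrow> f j1 j2 \<in> carrier_vec n"
    and B: "B \<in> carrier_vec n" and E2: "E2 \<in> carrier_vec n" and E1: "E1 \<in> carrier_vec n"
  shows "mat_exp (1 \<cdot>\<^sub>m L) *\<^sub>v state n Nv1 Nv2 f B E2 E1 =
    state n Nv1 Nv2
      (\<lambda>j1 j2. mat_exp (v1 j1 \<cdot>\<^sub>m X) *\<^sub>v f j1 j2)
      (((1/2) \<cdot>\<^sub>m (mat_exp (1 \<cdot>\<^sub>m X) + mat_exp ((- 1) \<cdot>\<^sub>m X))) *\<^sub>v B
        + ((1/2) \<cdot>\<^sub>m (mat_exp (1 \<cdot>\<^sub>m X) - mat_exp ((- 1) \<cdot>\<^sub>m X))) *\<^sub>v E2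
        + c \<cdot>\<^sub>v (G *\<^sub>v vel_sum n Nv1 Nv2 (\<lambda>j1 j2. v2 j2 \<cdot>\<^sub>v (\<alpha> j1 *\<^sub>v f j1 j2))))
      (((1/2) \<cdot>\<^sub>m (mat_exp (1 \<cdot>\<^sub>m X) - mat_exp ((- 1) \<cdot>\<^sub>m X))) *\<^sub>v B
        + ((1/2) \<cdot>\<^sub>m (mat_exp (1 \<cdot>\<^sub>m X) + mat_exp ((- 1) \<cdot>\<^sub>m X))) *\<^sub>v E2
        + c \<cdot>\<^sub>v (G *\<^sub>v vel_sum n Nv1 Nv2 (\<lambda>j1 j2. v2 j2 \<cdot>\<^sub>v (\<beta> j1 *\<^sub>v f j1 j2))))
      (E1 + c \<cdot>\<^sub>v (G *\<^sub>v vel_sum n Nv1 Nv2 (\<lambda>j1 j2. (1\<^sub>m n - mat_exp (v1 j1 \<cdot>\<^sub>m X)) *\<^sub>v f j1 j2)))"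
    (is "_ *\<^sub>v ?U = ?R")
proof -
  \<comment> \<open>Taylor coefficients of cosh, of sinh and of the constant 1.\<close>
  define p q \<delta> :: "nat \<Rightarrow> real" where "p m = (1 + (- 1) ^ m) / 2" and "q m = (1 - (- 1) ^ m) / 2"
    and "\<delta> m = (if m = 0 then 1 else 0)" for m
  define a b where "a v m = - 1 / (2 * (1 - v)) - (- 1) ^ m / (2 * (1 + v)) + v ^ m / (1 - v\<^sup>2)"
    and "b v m = - 1 / (2 * (1 - v)) + (- 1) ^ m / (2 * (1 + v)) + v * v ^ m / (1 - v\<^sup>2)"
    for v :: real and m
  define S where "S h m = vel_sum n Nv1 Nv2 (\<lambda>j1 j2. h j1 j2 \<cdot>\<^sub>v (X ^\<^sub>m m *\<^sub>v f j1 j2))" for h m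
  have pq: "p (Suc m) = q m" "q (Suc m) = p m" "p 0 = 1" "q 0 = 0" for m
    by (simp_all add: p_def q_def)
  have ab: "a v (Suc m) = b v m" "b v (Suc m) = a v m - v ^ m" "a v 0 = 0" "b v 0 = 0"
    if "v \<noteq> 1" "v \<noteq> -1" for v m
  proof -
    have nz: "1 - v \<noteq> 0" "1 + v \<noteq> 0" and sq: "1 - v\<^sup>2 = (1 - v) * (1 + v)"
      using that by (auto simp: power2_eq_square algebra_simps)
    show "a v (Suc m) = b v m" by (simp add: a_def b_def)
    show "a v 0 = 0" "b v 0 = 0"
      using nz unfolding a_def b_def sq by (simp_all add: divide_simps) (simp_all add: algebra_simps)
    define D where "D = (1 - v) * (1 + v)"
    have D: "D \<noteq> 0" using nz by (simp add: D_def)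
    \<comment> \<open>Since \<open>D\<close> is 1 - v^2, raising the exponent of the particular
      solution by two leaves the defect \<open>- v ^ m\<close>, the source term of the
      recursion.\<close>
    have "v * (v * v ^ m) = v ^ m - v ^ m * D" by (simp add: D_def algebra_simps)
    then have *: "v * (v * v ^ m) / D = v ^ m / D - v ^ m" using D by (simp add: diff_divide_distrib)
    have "x + - 1 * s / t + (y - z) = x - s / t + y - z" for x s t y z :: real by simp
    then show "b v (Suc m) = a v m - v ^ m"
      unfolding a_def b_def sq D_def[symmetric] power_Suc * .
  qed
  have Xm: "X ^\<^sub>m m \<in> carrier_mat n n" for m using X by simp
  have Xmv: "X ^\<^sub>m m *\<^sub>v u \<in> carrier_vec n" if "u \<in> carrier_vec n" for m u
    using mult_mat_vec_carrier[OF Xm that] .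
  have XXm: "X *\<^sub>v (X ^\<^sub>m m *\<^sub>v u) = X ^\<^sub>m Suc m *\<^sub>v u" if "u \<in> carrier_vec n" for m u
    using assoc_mult_mat_vec[OF X Xm that] mult_pow_mat_commute[OF X] by simp
  have Gv: "G *\<^sub>v u \<in> carrier_vec n" if "u \<in> carrier_vec n" for u
    using mult_mat_vec_carrier[OF G that] .
  have XGv: "X *\<^sub>v (G *\<^sub>v u) = G *\<^sub>v (X *\<^sub>v u)" if "u \<in> carrier_vec n" for u
    using assoc_mult_mat_vec[OF X G that] assoc_mult_mat_vec[OF G X that] GX by simp
  have Sc: "S h m \<in> carrier_vec n" for h m
    unfolding S_def using f by (intro vel_sum_carrier) (simp add: Xmv)
  have XS: "X *\<^sub>v S h m = S h (Suc m)" for h m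
    unfolding S_def using f Xmv
    by (subst mult_mat_vel_sum[OF X], simp, intro vel_sum_cong)
      (simp_all add: mult_mat_vec[OF X Xmv] XXm del: pow_mat.simps)
  have S_cong: "S h m = S h' m" if "\<And>j1 j2. j1 \<in> {1..Nv1} \<Longrightarrow> j2 \<in> {1..Nv2} \<Longrightarrow> h j1 j2 = h' j1 j2" for h h' m
    unfolding S_def using f that Xmv by (intro vel_sum_cong) auto
  have S_diff: "S (\<lambda>j1 j2. h j1 j2 - h' j1 j2) m = S h m - S h' m" for h h' m
  proof -
    have "S h m - S h' m = vel_sum n Nv1 Nv2
        (\<lambda>j1 j2. h j1 j2 \<cdot>\<^sub>v (X ^\<^sub>m m *\<^sub>v f j1 j2) - h' j1 j2 \<cdot>\<^sub>v (X ^\<^sub>m m *\<^sub>v f j1 j2))"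
      unfolding S_def using f Xmv by (intro vel_sum_diff[symmetric]) auto
    also have "\<dots> = S (\<lambda>j1 j2. h j1 j2 - h' j1 j2) m"
      unfolding S_def using f Xmv
      by (intro vel_sum_cong) (auto intro!: eq_vecI simp: left_diff_distrib)
    finally show ?thesis by simp
  qed
  have S0: "S (\<lambda>_ _. 0) m = 0\<^sub>v n" for m
  proof -
    have "S (\<lambda>_ _. 0) m - S (\<lambda>_ _. 0) m = 0\<^sub>v n" by (intro eq_vecI) (auto simp: carrier_vecD[OF Sc])
    then show ?thesis using S_diff[of "\<lambda>_ _. 0" "\<lambda>_ _. 0" m] by simp
  qed
  \<comment> \<open>The currents in the action of \<open>L\<close> take this form when applied to
    the \<open>m\<close>-th coefficients; the factor \<open>X\<close> raises the power by
    one.\<close>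
  have GS: "vel_sum n Nv1 Nv2 (\<lambda>j1 j2. h j1 j2 \<cdot>\<^sub>v (G *\<^sub>v (X *\<^sub>v (w j1 j2 \<cdot>\<^sub>v (X ^\<^sub>m m *\<^sub>v f j1 j2)))))
      = G *\<^sub>v S (\<lambda>j1 j2. h j1 j2 * w j1 j2) (Suc m)" for h w m
  proof -
    have "h j1 j2 \<cdot>\<^sub>v (G *\<^sub>v (X *\<^sub>v (w j1 j2 \<cdot>\<^sub>v (X ^\<^sub>m m *\<^sub>v f j1 j2)))) =
        G *\<^sub>v ((h j1 j2 * w j1 j2) \<cdot>\<^sub>v (X ^\<^sub>m Suc m *\<^sub>v f j1 j2))"
      if "j1 \<in> {1..Nv1}" "j2 \<in> {1..Nv2}" for j1 j2
      unfolding mult_mat_vec[OF X Xmv[OF f[OF that]]] XXm[OF f[OF that]]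
        mult_mat_vec[OF G Xmv[OF f[OF that]]] smult_smult_assoc ..
    moreover have "G *\<^sub>v S (\<lambda>j1 j2. h j1 j2 * w j1 j2) (Suc m) =
        vel_sum n Nv1 Nv2 (\<lambda>j1 j2. G *\<^sub>v ((h j1 j2 * w j1 j2) \<cdot>\<^sub>v (X ^\<^sub>m Suc m *\<^sub>v f j1 j2)))"
      unfolding S_def using f Xmv by (intro mult_mat_vel_sum[OF G]) (simp del: pow_mat.simps)
    ultimately show ?thesis
      by (simp only:) (intro vel_sum_cong Gv smult_carrier_vec[THEN iffD2] Xmv f)
  qed
  \<comment> \<open>The blocks of \<open>L ^\<^sub>m m *\<^sub>v ?U\<close>: each coefficient of the claimed exponential is replaced by its
    \<open>m\<close>-th exponential Taylor coefficient.  The recursion \<open>L *\<^sub>v y m = y (Suc m)\<close> comes down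
    to \<open>a v (Suc m) = b v m\<close> and \<open>b v (Suc m) = a v m - v ^ m\<close>.\<close>
  define y where "y m = state n Nv1 Nv2
      (\<lambda>j1 j2. (v1 j1) ^ m \<cdot>\<^sub>v (X ^\<^sub>m m *\<^sub>v f j1 j2))
      (p m \<cdot>\<^sub>v (X ^\<^sub>m m *\<^sub>v B) + q m \<cdot>\<^sub>v (X ^\<^sub>m m *\<^sub>v E2) + c \<cdot>\<^sub>v (G *\<^sub>v S (\<lambda>j1 j2. v2 j2 * a (v1 j1) m) m))
      (q m \<cdot>\<^sub>v (X ^\<^sub>m m *\<^sub>v B) + p m \<cdot>\<^sub>v (X ^\<^sub>m m *\<^sub>v E2) + c \<cdot>\<^sub>v (G *\<^sub>v S (\<lambda>j1 j2. v2 j2 * b (v1 j1) m) m))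
      (\<delta> m \<cdot>\<^sub>v E1 + c \<cdot>\<^sub>v (G *\<^sub>v S (\<lambda>j1 j2. \<delta> m - (v1 j1) ^ m) m))" for m
  have y0: "y 0 = ?U"
  proof -
    have "S (\<lambda>j1 j2. v2 j2 * a (v1 j1) 0) 0 = 0\<^sub>v n" "S (\<lambda>j1 j2. v2 j2 * b (v1 j1) 0) 0 = 0\<^sub>v n"
      "S (\<lambda>j1 j2. \<delta> 0 - (v1 j1) ^ 0) 0 = 0\<^sub>v n"
      unfolding S0[of 0, symmetric] using ab nonresonant by (intro S_cong; simp add: \<delta>_def)+
    moreover have "G *\<^sub>v 0\<^sub>v n = 0\<^sub>v n" using G by (intro eq_vecI) auto
    moreover have "c \<cdot>\<^sub>v 0\<^sub>v n = 0\<^sub>v n" by (intro eq_vecI) auto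
    moreover have "0 \<cdot>\<^sub>v u = 0\<^sub>v n" if "u \<in> carrier_vec n" for u :: "real vec"
      using that by (auto intro!: eq_vecI)
    ultimately show ?thesis
      unfolding y_def using X B E2 E1 f by (intro state_cong) (simp_all add: pq \<delta>_def)
  qed
  have y_Suc: "L *\<^sub>v y m = y (Suc m)" for m
  proof -
    have "L *\<^sub>v y m = state n Nv1 Nv2
        (\<lambda>j1 j2. v1 j1 \<cdot>\<^sub>v (X *\<^sub>v ((v1 j1) ^ m \<cdot>\<^sub>v (X ^\<^sub>m m *\<^sub>v f j1 j2))))
        (X *\<^sub>v (q m \<cdot>\<^sub>v (X ^\<^sub>m m *\<^sub>v B) + p m \<cdot>\<^sub>v (X ^\<^sub>m m *\<^sub>v E2) + c \<cdot>\<^sub>v (G *\<^sub>v S (\<lambda>j1 j2. v2 j2 * b (v1 j1) m) m)))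
        (X *\<^sub>v (p m \<cdot>\<^sub>v (X ^\<^sub>m m *\<^sub>v B) + q m \<cdot>\<^sub>v (X ^\<^sub>m m *\<^sub>v E2) + c \<cdot>\<^sub>v (G *\<^sub>v S (\<lambda>j1 j2. v2 j2 * a (v1 j1) m) m))
          - c \<cdot>\<^sub>v (G *\<^sub>v S (\<lambda>j1 j2. v2 j2 * v1 j1 ^ m) (Suc m)))
        (- (c \<cdot>\<^sub>v (G *\<^sub>v S (\<lambda>j1 j2. v1 j1 * v1 j1 ^ m) (Suc m))))"
      unfolding y_def GS[symmetric] using f B E2 E1
      by (intro L_action) (simp_all add: Xmv Gv Sc)
    also have "\<dots> = y (Suc m)"
      unfolding y_def
    proof (rule state_cong)
      have X_lin: "X *\<^sub>v (s \<cdot>\<^sub>v (X ^\<^sub>m m *\<^sub>v B) + t \<cdot>\<^sub>v (X ^\<^sub>m m *\<^sub>v E2) + c \<cdot>\<^sub>v (G *\<^sub>v S h m)) =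
          s \<cdot>\<^sub>v (X ^\<^sub>m Suc m *\<^sub>v B) + t \<cdot>\<^sub>v (X ^\<^sub>m Suc m *\<^sub>v E2) + c \<cdot>\<^sub>v (G *\<^sub>v S h (Suc m))" for s t h
        using B E2 by (simp add: mult_add_distrib_mat_vec[OF X] mult_mat_vec[OF X] Xmv Gv Sc XXm XGv XS
            del: pow_mat.simps)
      show "v1 j1 \<cdot>\<^sub>v (X *\<^sub>v ((v1 j1) ^ m \<cdot>\<^sub>v (X ^\<^sub>m m *\<^sub>v f j1 j2))) =
          (v1 j1) ^ Suc m \<cdot>\<^sub>v (X ^\<^sub>m Suc m *\<^sub>v f j1 j2)" if "j1 \<in> {1..Nv1}" "j2 \<in> {1..Nv2}" for j1 j2
        using f[OF that] by (simp add: mult_mat_vec[OF X Xmv] XXm smult_smult_assoc del: pow_mat.simps)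
      have "S (\<lambda>j1 j2. v2 j2 * b (v1 j1) m) (Suc m) = S (\<lambda>j1 j2. v2 j2 * a (v1 j1) (Suc m)) (Suc m)"
        using ab nonresonant by (intro S_cong) simp
      then show "X *\<^sub>v (q m \<cdot>\<^sub>v (X ^\<^sub>m m *\<^sub>v B) + p m \<cdot>\<^sub>v (X ^\<^sub>m m *\<^sub>v E2)
            + c \<cdot>\<^sub>v (G *\<^sub>v S (\<lambda>j1 j2. v2 j2 * b (v1 j1) m) m)) =
          p (Suc m) \<cdot>\<^sub>v (X ^\<^sub>m Suc m *\<^sub>v B) + q (Suc m) \<cdot>\<^sub>v (X ^\<^sub>m Suc m *\<^sub>v E2)
            + c \<cdot>\<^sub>v (G *\<^sub>v S (\<lambda>j1 j2. v2 j2 * a (v1 j1) (Suc m)) (Suc m))"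
        unfolding X_lin by (simp only: pq)
      \<comment> \<open>The current contributes \<open>v2 j2 * v1 j1 ^ m\<close>, exactly the amount
        by which \<open>b (v1 j1) (Suc m)\<close> falls short of \<open>a (v1 j1) m\<close>, up to
        the factor \<open>v2 j2\<close>.\<close>
      have "S (\<lambda>j1 j2. v2 j2 * b (v1 j1) (Suc m)) (Suc m) =
          S (\<lambda>j1 j2. v2 j2 * a (v1 j1) m) (Suc m) - S (\<lambda>j1 j2. v2 j2 * v1 j1 ^ m) (Suc m)"
        unfolding S_diff[symmetric] using ab nonresonant by (intro S_cong) (simp add: right_diff_distrib)
      then have G_S: "G *\<^sub>v S (\<lambda>j1 j2. v2 j2 * b (v1 j1) (Suc m)) (Suc m) =
          G *\<^sub>v S (\<lambda>j1 j2. v2 j2 * a (v1 j1) m) (Suc m) - G *\<^sub>v S (\<lambda>j1 j2. v2 j2 * v1 j1 ^ m) (Suc m)"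
        using mult_minus_distrib_mat_vec[OF G Sc Sc] by simp
      have vec_eq: "t1 + t2 + c \<cdot>\<^sub>v u1 - c \<cdot>\<^sub>v u2 = t1 + t2 + c \<cdot>\<^sub>v (u1 - u2)"
        if "t1 \<in> carrier_vec n" "t2 \<in> carrier_vec n" "u1 \<in> carrier_vec n" "u2 \<in> carrier_vec n"
        for t1 t2 u1 u2
        using that by (intro eq_vecI) (auto simp: algebra_simps)
      show "X *\<^sub>v (p m \<cdot>\<^sub>v (X ^\<^sub>m m *\<^sub>v B) + q m \<cdot>\<^sub>v (X ^\<^sub>m m *\<^sub>v E2)
            + c \<cdot>\<^sub>v (G *\<^sub>v S (\<lambda>j1 j2. v2 j2 * a (v1 j1) m) m))
          - c \<cdot>\<^sub>v (G *\<^sub>v S (\<lambda>j1 j2. v2 j2 * v1 j1 ^ m) (Suc m)) =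
          q (Suc m) \<cdot>\<^sub>v (X ^\<^sub>m Suc m *\<^sub>v B) + p (Suc m) \<cdot>\<^sub>v (X ^\<^sub>m Suc m *\<^sub>v E2)
            + c \<cdot>\<^sub>v (G *\<^sub>v S (\<lambda>j1 j2. v2 j2 * b (v1 j1) (Suc m)) (Suc m))"
        unfolding X_lin pq G_S by (intro vec_eq smult_carrier_vec[THEN iffD2] Xmv Gv Sc B E2)
      \<comment> \<open>\<open>\<delta> (Suc m)\<close> is zero, so the constant \<open>E1\<close>
        survives only at order 0 and the later coefficients consist of the current alone.\<close>
      have "S (\<lambda>j1 j2. \<delta> (Suc m) - v1 j1 ^ Suc m) (Suc m) =
          0\<^sub>v n - S (\<lambda>j1 j2. v1 j1 * v1 j1 ^ m) (Suc m)"
        unfolding S0[of "Suc m", symmetric] S_diff[symmetric] by (simp add: \<delta>_def)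
      then have "G *\<^sub>v S (\<lambda>j1 j2. \<delta> (Suc m) - v1 j1 ^ Suc m) (Suc m) =
          G *\<^sub>v 0\<^sub>v n - G *\<^sub>v S (\<lambda>j1 j2. v1 j1 * v1 j1 ^ m) (Suc m)"
        using mult_minus_distrib_mat_vec[OF G _ Sc] by simp
      moreover have "G *\<^sub>v 0\<^sub>v n = 0\<^sub>v n" using G by (intro eq_vecI) auto
      moreover have "- (c \<cdot>\<^sub>v u) = 0 \<cdot>\<^sub>v E1 + c \<cdot>\<^sub>v (0\<^sub>v n - u)" if "u \<in> carrier_vec n" for u
        using that E1 by (intro eq_vecI) auto
      ultimately show "- (c \<cdot>\<^sub>v (G *\<^sub>v S (\<lambda>j1 j2. v1 j1 * v1 j1 ^ m) (Suc m))) =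
          \<delta> (Suc m) \<cdot>\<^sub>v E1 + c \<cdot>\<^sub>v (G *\<^sub>v S (\<lambda>j1 j2. \<delta> (Suc m) - v1 j1 ^ Suc m) (Suc m))"
        by (simp add: Gv Sc \<delta>_def)
    qed
    finally show ?thesis .
  qed
  \<comment> \<open>The factor \<open>1 ^ m\<close> matches the series of
    \<open>exp_sums_mat_exp\<close> at scalar 1.\<close>
  have y_eq: "1 ^ m \<cdot>\<^sub>v (L ^\<^sub>m m *\<^sub>v ?U) = y m" for m
  proof (induction m)
    case 0
    show ?case using L state_carrier y0 by simp
  next
    case (Suc m)
    have Lm: "L ^\<^sub>m m \<in> carrier_mat (state_dim n Nv1 Nv2) (state_dim n Nv1 Nv2)" using L by simp
    show ?case
      using Suc y_Suc[of m] assoc_mult_mat_vec[OF L Lm state_carrier, of f B E2 E1] mult_pow_mat_commute[OF L, of m]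
      by simp
  qed
  have e: "exp_sums n (\<lambda>m. x ^ m \<cdot>\<^sub>v (X ^\<^sub>m m *\<^sub>v u)) (mat_exp (x \<cdot>\<^sub>m X) *\<^sub>v u)"
    if "u \<in> carrier_vec n" for x u
    using exp_sums_mat_exp[OF X that] .
  have ec: "mat_exp (x \<cdot>\<^sub>m X) \<in> carrier_mat n n" for x
    using X by (auto simp: mat_exp_def)
  have ep: "exp_sums n (\<lambda>m. p m \<cdot>\<^sub>v (X ^\<^sub>m m *\<^sub>v u))
      (((1/2) \<cdot>\<^sub>m (mat_exp (1 \<cdot>\<^sub>m X) + mat_exp ((- 1) \<cdot>\<^sub>m X))) *\<^sub>v u)"
    and eq: "exp_sums n (\<lambda>m. q m \<cdot>\<^sub>v (X ^\<^sub>m m *\<^sub>v u))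
      (((1/2) \<cdot>\<^sub>m (mat_exp (1 \<cdot>\<^sub>m X) - mat_exp ((- 1) \<cdot>\<^sub>m X))) *\<^sub>v u)"
    if u: "u \<in> carrier_vec n" for u
  proof -
    note e1 = e[OF u, of 1] and e2 = e[OF u, of "- 1"]
    have "((1/2) \<cdot>\<^sub>m (mat_exp (1 \<cdot>\<^sub>m X) + mat_exp ((- 1) \<cdot>\<^sub>m X))) *\<^sub>v u =
        (1/2) \<cdot>\<^sub>v (mat_exp (1 \<cdot>\<^sub>m X) *\<^sub>v u + mat_exp ((- 1) \<cdot>\<^sub>m X) *\<^sub>v u)"
      "((1/2) \<cdot>\<^sub>m (mat_exp (1 \<cdot>\<^sub>m X) - mat_exp ((- 1) \<cdot>\<^sub>m X))) *\<^sub>v u =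
        (1/2) \<cdot>\<^sub>v (mat_exp (1 \<cdot>\<^sub>m X) *\<^sub>v u - mat_exp ((- 1) \<cdot>\<^sub>m X) *\<^sub>v u)"
      using u ec[of 1] ec[of "- 1"]
      by (simp_all add: smult_mat_mult_vec[of _ n n] add_mult_distrib_mat_vec[of _ n n]
          minus_mult_distrib_mat_vec[of _ n n] minus_carrier_mat)
    moreover have "(1/2) \<cdot>\<^sub>v (1 ^ m \<cdot>\<^sub>v (X ^\<^sub>m m *\<^sub>v u) + (- 1) ^ m \<cdot>\<^sub>v (X ^\<^sub>m m *\<^sub>v u)) = p m \<cdot>\<^sub>v (X ^\<^sub>m m *\<^sub>v u)"
      "(1/2) \<cdot>\<^sub>v (1 ^ m \<cdot>\<^sub>v (X ^\<^sub>m m *\<^sub>v u) - (- 1) ^ m \<cdot>\<^sub>v (X ^\<^sub>m m *\<^sub>v u)) = q m \<cdot>\<^sub>v (X ^\<^sub>m m *\<^sub>v u)" for m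
      using Xmv[OF u, of m] by (auto intro!: eq_vecI simp: p_def q_def field_simps)
    ultimately show "exp_sums n (\<lambda>m. p m \<cdot>\<^sub>v (X ^\<^sub>m m *\<^sub>v u))
        (((1/2) \<cdot>\<^sub>m (mat_exp (1 \<cdot>\<^sub>m X) + mat_exp ((- 1) \<cdot>\<^sub>m X))) *\<^sub>v u)"
      "exp_sums n (\<lambda>m. q m \<cdot>\<^sub>v (X ^\<^sub>m m *\<^sub>v u))
        (((1/2) \<cdot>\<^sub>m (mat_exp (1 \<cdot>\<^sub>m X) - mat_exp ((- 1) \<cdot>\<^sub>m X))) *\<^sub>v u)"
      using exp_sums_smult[OF exp_sums_add[OF e1 e2], of "1/2"]
        exp_sums_smult[OF exp_sums_minus[OF e1 e2], of "1/2"] by simp_all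
  qed
  have ea: "exp_sums n (\<lambda>m. a (v1 j) m \<cdot>\<^sub>v (X ^\<^sub>m m *\<^sub>v u)) (\<alpha> j *\<^sub>v u)"
    and eb: "exp_sums n (\<lambda>m. b (v1 j) m \<cdot>\<^sub>v (X ^\<^sub>m m *\<^sub>v u)) (\<beta> j *\<^sub>v u)"
    if u: "u \<in> carrier_vec n" and j: "j \<in> {1..Nv1}" for u j
  proof -
    \<comment> \<open>The three exponentials have the coefficients 1, \<open>(- 1) ^ m\<close> and
      \<open>v1 j ^ m\<close>; these weights combine them to \<open>a\<close>, and with
      \<open>z'\<close> and the other sign of \<open>y\<close> to \<open>b\<close>.\<close>
    define x y z z' where "x = - 1 / (2 * (1 - v1 j))" and "y = 1 / (2 * (1 + v1 j))"
      and "z = 1 / (1 - (v1 j)\<^sup>2)" and "z' = v1 j / (1 - (v1 j)\<^sup>2)"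
    note e1 = e[OF u, of 1] and e2 = e[OF u, of "- 1"] and e3 = e[OF u, of "v1 j"]
    have "\<alpha> j *\<^sub>v u = x \<cdot>\<^sub>v (mat_exp (1 \<cdot>\<^sub>m X) *\<^sub>v u) - y \<cdot>\<^sub>v (mat_exp ((- 1) \<cdot>\<^sub>m X) *\<^sub>v u)
        + z \<cdot>\<^sub>v (mat_exp (v1 j \<cdot>\<^sub>m X) *\<^sub>v u)"
      "\<beta> j *\<^sub>v u = x \<cdot>\<^sub>v (mat_exp (1 \<cdot>\<^sub>m X) *\<^sub>v u) + y \<cdot>\<^sub>v (mat_exp ((- 1) \<cdot>\<^sub>m X) *\<^sub>v u)
        + z' \<cdot>\<^sub>v (mat_exp (v1 j \<cdot>\<^sub>m X) *\<^sub>v u)"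
      unfolding \<alpha>[OF j] \<beta>[OF j] x_def[symmetric] y_def[symmetric] z_def[symmetric] z'_def[symmetric]
      using u ec[of 1] ec[of "- 1"] ec[of "v1 j"]
      by (simp_all add: smult_mat_mult_vec[of _ n n] add_mult_distrib_mat_vec[of _ n n]
          minus_mult_distrib_mat_vec[of _ n n] minus_carrier_mat)
    moreover have "x \<cdot>\<^sub>v (1 ^ m \<cdot>\<^sub>v w) - y \<cdot>\<^sub>v ((- 1) ^ m \<cdot>\<^sub>v w) + z \<cdot>\<^sub>v (v1 j ^ m \<cdot>\<^sub>v w) = a (v1 j) m \<cdot>\<^sub>v w"
      "x \<cdot>\<^sub>v (1 ^ m \<cdot>\<^sub>v w) + y \<cdot>\<^sub>v ((- 1) ^ m \<cdot>\<^sub>v w) + z' \<cdot>\<^sub>v (v1 j ^ m \<cdot>\<^sub>v w) = b (v1 j) m \<cdot>\<^sub>v w" for m w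
    proof -
      have ab_eq: "a (v1 j) m = x - y * (- 1) ^ m + z * v1 j ^ m" "b (v1 j) m = x + y * (- 1) ^ m + z' * v1 j ^ m"
        by (simp_all add: a_def b_def x_def y_def z_def z'_def)
      show "x \<cdot>\<^sub>v (1 ^ m \<cdot>\<^sub>v w) - y \<cdot>\<^sub>v ((- 1) ^ m \<cdot>\<^sub>v w) + z \<cdot>\<^sub>v (v1 j ^ m \<cdot>\<^sub>v w) = a (v1 j) m \<cdot>\<^sub>v w"
        "x \<cdot>\<^sub>v (1 ^ m \<cdot>\<^sub>v w) + y \<cdot>\<^sub>v ((- 1) ^ m \<cdot>\<^sub>v w) + z' \<cdot>\<^sub>v (v1 j ^ m \<cdot>\<^sub>v w) = b (v1 j) m \<cdot>\<^sub>v w"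
        unfolding ab_eq by (auto intro!: eq_vecI simp: algebra_simps)
    qed
    ultimately show "exp_sums n (\<lambda>m. a (v1 j) m \<cdot>\<^sub>v (X ^\<^sub>m m *\<^sub>v u)) (\<alpha> j *\<^sub>v u)"
      "exp_sums n (\<lambda>m. b (v1 j) m \<cdot>\<^sub>v (X ^\<^sub>m m *\<^sub>v u)) (\<beta> j *\<^sub>v u)"
      using exp_sums_add[OF exp_sums_minus[OF exp_sums_smult[OF e1, of x] exp_sums_smult[OF e2, of y]]
          exp_sums_smult[OF e3, of z]]
        exp_sums_add[OF exp_sums_add[OF exp_sums_smult[OF e1, of x] exp_sums_smult[OF e2, of y]]
          exp_sums_smult[OF e3, of z']] by simp_all
  qed
  have e\<delta>: "exp_sums n (\<lambda>m. (\<delta> m - v1 j ^ m) \<cdot>\<^sub>v (X ^\<^sub>m m *\<^sub>v u)) ((1\<^sub>m n - mat_exp (v1 j \<cdot>\<^sub>m X)) *\<^sub>v u)"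
    if u: "u \<in> carrier_vec n" for u j
  proof -
    have "(1\<^sub>m n - mat_exp (v1 j \<cdot>\<^sub>m X)) *\<^sub>v u = u - mat_exp (v1 j \<cdot>\<^sub>m X) *\<^sub>v u"
      using u ec[of "v1 j"] by (simp add: minus_mult_distrib_mat_vec[of _ n n])
    moreover have "(if m = 0 then 1 else 0) \<cdot>\<^sub>v u - v1 j ^ m \<cdot>\<^sub>v (X ^\<^sub>m m *\<^sub>v u) =
        (\<delta> m - v1 j ^ m) \<cdot>\<^sub>v (X ^\<^sub>m m *\<^sub>v u)" for m
      using u X Xmv[OF u, of m] by (cases "m = 0") (auto intro!: eq_vecI simp: \<delta>_def algebra_simps)
    ultimately show ?thesis
      using exp_sums_minus[OF exp_sums_const[OF u] e[OF u, of "v1 j"]] by simp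
  qed
  \<comment> \<open>One statement for all three velocity sums: the weight \<open>x\<close> is
    \<open>v2\<close> for the two coupled fields and constantly 1 for \<open>E1\<close>.\<close>
  have eGS: "exp_sums n (\<lambda>m. c \<cdot>\<^sub>v (G *\<^sub>v S (\<lambda>j1 j2. x j2 * h (v1 j1) m) m))
      (c \<cdot>\<^sub>v (G *\<^sub>v vel_sum n Nv1 Nv2 (\<lambda>j1 j2. x j2 \<cdot>\<^sub>v (s j1 *\<^sub>v f j1 j2))))"
    if "\<And>j u. j \<in> {1..Nv1} \<Longrightarrow> u \<in> carrier_vec n \<Longrightarrow>
      exp_sums n (\<lambda>m. h (v1 j) m \<cdot>\<^sub>v (X ^\<^sub>m m *\<^sub>v u)) (s j *\<^sub>v u)" for x h s
    unfolding S_def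
    by (intro exp_sums_smult exp_sums_mult_mat_vec[OF _ G] exp_sums_vel_sum)
      (unfold smult_smult_assoc[symmetric], intro exp_sums_smult that f)
  \<comment> \<open>The right-hand side sums the coefficients \<open>y\<close> block by block, and
    the exponential sums the same \<open>y\<close> as powers of \<open>L\<close>; limits are
    unique.\<close>
  have "exp_sums (state_dim n Nv1 Nv2) y ?R"
    unfolding y_def
  proof (intro exp_sums_state exp_sums_add)
    show "exp_sums n (\<lambda>m. v1 j1 ^ m \<cdot>\<^sub>v (X ^\<^sub>m m *\<^sub>v f j1 j2)) (mat_exp (v1 j1 \<cdot>\<^sub>m X) *\<^sub>v f j1 j2)"
      if "j1 \<in> {1..Nv1}" "j2 \<in> {1..Nv2}" for j1 j2
      using f[OF that] by (rule e)
    show "exp_sums n (\<lambda>m. c \<cdot>\<^sub>v (G *\<^sub>v S (\<lambda>j1 j2. \<delta> m - v1 j1 ^ m) m))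
        (c \<cdot>\<^sub>v (G *\<^sub>v vel_sum n Nv1 Nv2 (\<lambda>j1 j2. (1\<^sub>m n - mat_exp (v1 j1 \<cdot>\<^sub>m X)) *\<^sub>v f j1 j2)))"
      using eGS[of "\<lambda>v m. \<delta> m - v ^ m" "\<lambda>j. 1\<^sub>m n - mat_exp (v1 j \<cdot>\<^sub>m X)" "\<lambda>_. 1", OF e\<delta>] by simp
    show "exp_sums n (\<lambda>m. \<delta> m \<cdot>\<^sub>v E1) E1"
      unfolding \<delta>_def by (rule exp_sums_const[OF E1])
  qed (intro ep eq B E2 eGS ea eb; assumption)+
  moreover have "exp_sums (state_dim n Nv1 Nv2) y (mat_exp (1 \<cdot>\<^sub>m L) *\<^sub>v ?U)"
    using exp_sums_mat_exp[OF L state_carrier, of 1 f B E2 E1] unfolding y_eq .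
  ultimately show ?thesis by (rule exp_sums_unique[rotated])
qed

text \<open>It remains to pass from unit time to \<open>dt\<close> by scaling \<open>A\<close> and
  \<open>L\<close>. Every vector of the right dimension is a state, so the assumed action determines
  \<open>L\<close>. Invertibility of \<open>A + P\<close> is part of the conclusion because it gives
  \<open>mat_inv (A + P)\<close> its meaning.\<close>

theorem proposition4:
  fixes k Nx Nv1 Nv2 n :: nat
    and L0 vmax1 vmax2 dt dv1 dv2 :: real
    and v1 v2 :: "nat \<Rightarrow> real"
    and A P L :: "real mat"
    and \<alpha> \<beta> :: "nat \<Rightarrow> real mat"
    and f :: "nat \<Rightarrow> nat \<Rightarrow> real vec"
    and B E2 E1 :: "real vec"
  assumes "Nx \<ge> 1" and "L0 > 0" and "vmax1 > 0" and "vmax2 > 0"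
    and "Nv1 \<ge> 1" and "Nv2 \<ge> 1" and "dt > 0"
    and n: "n = (k + 1) * Nx"
    and A: "A = dg_matrix k Nx (L0 / real Nx)"
    and P: "is_orthogonal_projection n (dg_inner k Nx (L0 / real Nx)) (mat_kernel A) P"
    and dv1: "dv1 = vel_step vmax1 Nv1" and dv2: "dv2 = vel_step vmax2 Nv2"
    and v1: "v1 = vel vmax1 Nv1" and v2: "v2 = vel vmax2 Nv2"
    and nonresonant: "\<forall>j \<in> {1..Nv1}. v1 j \<noteq> 1 \<and> v1 j \<noteq> -1"
    and L_carrier: "L \<in> carrier_mat (state_dim n Nv1 Nv2) (state_dim n Nv1 Nv2)"
    and L_action:
      "\<forall>g B' E2' E1'.
         (\<forall>j1 \<in> {1..Nv1}. \<forall>j2 \<in> {1..Nv2}. g j1 j2 \<in> carrier_vec n) \<longrightarrow>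
         B' \<in> carrier_vec n \<longrightarrow> E2' \<in> carrier_vec n \<longrightarrow> E1' \<in> carrier_vec n \<longrightarrow>
         L *\<^sub>v state n Nv1 Nv2 g B' E2' E1' =
         state n Nv1 Nv2
           (\<lambda>j1 j2. v1 j1 \<cdot>\<^sub>v (A *\<^sub>v g j1 j2))
           (A *\<^sub>v E2')
           (A *\<^sub>v B' - (dv1 * dv2) \<cdot>\<^sub>v
              vel_sum n Nv1 Nv2 (\<lambda>j1 j2. v2 j2 \<cdot>\<^sub>v ((1\<^sub>m n - P) *\<^sub>v g j1 j2)))
           (- ((dv1 * dv2) \<cdot>\<^sub>v
              vel_sum n Nv1 Nv2 (\<lambda>j1 j2. v1 j1 \<cdot>\<^sub>v ((1\<^sub>m n - P) *\<^sub>v g j1 j2))))"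
    and \<alpha>: "\<forall>j \<in> {1..Nv1}. \<alpha> j =
        (- 1 / (2 * (1 - v1 j))) \<cdot>\<^sub>m mat_exp (dt \<cdot>\<^sub>m A)
        - (1 / (2 * (1 + v1 j))) \<cdot>\<^sub>m mat_exp ((- dt) \<cdot>\<^sub>m A)
        + (1 / (1 - (v1 j)\<^sup>2)) \<cdot>\<^sub>m mat_exp ((dt * v1 j) \<cdot>\<^sub>m A)"
    and \<beta>: "\<forall>j \<in> {1..Nv1}. \<beta> j =
        (- 1 / (2 * (1 - v1 j))) \<cdot>\<^sub>m mat_exp (dt \<cdot>\<^sub>m A)
        + (1 / (2 * (1 + v1 j))) \<cdot>\<^sub>m mat_exp ((- dt) \<cdot>\<^sub>m A)
        + (v1 j / (1 - (v1 j)\<^sup>2)) \<cdot>\<^sub>m mat_exp ((dt * v1 j) \<cdot>\<^sub>m A)"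
    and f: "\<forall>j1 \<in> {1..Nv1}. \<forall>j2 \<in> {1..Nv2}. f j1 j2 \<in> carrier_vec n"
    and B: "B \<in> carrier_vec n" and E2: "E2 \<in> carrier_vec n" and E1: "E1 \<in> carrier_vec n"
  shows "invertible_mat (A + P) \<and>
    mat_exp (dt \<cdot>\<^sub>m L) *\<^sub>v state n Nv1 Nv2 f B E2 E1 =
    state n Nv1 Nv2
      (\<lambda>j1 j2. mat_exp ((v1 j1 * dt) \<cdot>\<^sub>m A) *\<^sub>v f j1 j2)
      (((1/2) \<cdot>\<^sub>m (mat_exp (dt \<cdot>\<^sub>m A) + mat_exp ((- dt) \<cdot>\<^sub>m A))) *\<^sub>v B
        + ((1/2) \<cdot>\<^sub>m (mat_exp (dt \<cdot>\<^sub>m A) - mat_exp ((- dt) \<cdot>\<^sub>m A))) *\<^sub>v E2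
        + (dv1 * dv2) \<cdot>\<^sub>v (mat_inv (A + P) *\<^sub>v
            vel_sum n Nv1 Nv2 (\<lambda>j1 j2. v2 j2 \<cdot>\<^sub>v (\<alpha> j1 *\<^sub>v f j1 j2))))
      (((1/2) \<cdot>\<^sub>m (mat_exp (dt \<cdot>\<^sub>m A) - mat_exp ((- dt) \<cdot>\<^sub>m A))) *\<^sub>v B
        + ((1/2) \<cdot>\<^sub>m (mat_exp (dt \<cdot>\<^sub>m A) + mat_exp ((- dt) \<cdot>\<^sub>m A))) *\<^sub>v E2
        + (dv1 * dv2) \<cdot>\<^sub>v (mat_inv (A + P) *\<^sub>v
            vel_sum n Nv1 Nv2 (\<lambda>j1 j2. v2 j2 \<cdot>\<^sub>v (\<beta> j1 *\<^sub>v f j1 j2))))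
      (E1
        + (dv1 * dv2) \<cdot>\<^sub>v (mat_inv (A + P) *\<^sub>v
            vel_sum n Nv1 Nv2 (\<lambda>j1 j2. (1\<^sub>m n - mat_exp ((v1 j1 * dt) \<cdot>\<^sub>m A)) *\<^sub>v f j1 j2)))"
proof -
  define dx where "dx = L0 / real Nx"
  define G where "G = mat_inv (A + P)"
  define X where "X = dt \<cdot>\<^sub>m A"
  define c where "c = dv1 * dv2"
  have dx: "dx > 0" using \<open>Nx \<ge> 1\<close> \<open>L0 > 0\<close> by (simp add: dx_def)
  have Ac: "A \<in> carrier_mat n n" unfolding A n by (rule dg_matrix_carrier)
  note proj = dg_projection[OF dx n A[folded dx_def] P[folded dx_def]]
  note inv = add_kernel_projection_inverse[OF Ac proj]
  have G: "G \<in> carrier_mat n n" and GA: "1\<^sub>m n - P = G * A" and AG: "A * G = G * A"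
    using inv(2-4) by (simp_all add: G_def)
  have X: "X \<in> carrier_mat n n" using Ac by (simp add: X_def)
  have XG: "X * G = G * X"
    unfolding X_def mult_smult_assoc_mat[OF Ac G] mult_smult_distrib[OF G Ac] AG ..
  have Xv: "X *\<^sub>v u = dt \<cdot>\<^sub>v (A *\<^sub>v u)" if "u \<in> carrier_vec n" for u
    unfolding X_def by (rule smult_mat_mult_vec[OF Ac that])
  have Av: "A *\<^sub>v u \<in> carrier_vec n" and Gv: "G *\<^sub>v u \<in> carrier_vec n"
    if "u \<in> carrier_vec n" for u
    using mult_mat_vec_carrier[OF Ac that] mult_mat_vec_carrier[OF G that] by auto
  \<comment> \<open>Here the projection disappears from the system: a projected vector scaled by
    \<open>dt\<close> is \<open>G\<close> applied to \<open>X u\<close>.\<close>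
  have GXv: "G *\<^sub>v (X *\<^sub>v u) = dt \<cdot>\<^sub>v ((1\<^sub>m n - P) *\<^sub>v u)" if "u \<in> carrier_vec n" for u
    unfolding Xv[OF that] mult_mat_vec[OF G Av[OF that]] GA assoc_mult_mat_vec[OF G Ac that] ..
  have Qv: "(1\<^sub>m n - P) *\<^sub>v u \<in> carrier_vec n" if "u \<in> carrier_vec n" for u
    unfolding GA assoc_mult_mat_vec[OF G Ac that] by (intro Gv Av that)
  have V_smult: "vel_sum n Nv1 Nv2 (\<lambda>j1 j2. w j1 j2 \<cdot>\<^sub>v (G *\<^sub>v (X *\<^sub>v g j1 j2))) =
      dt \<cdot>\<^sub>v vel_sum n Nv1 Nv2 (\<lambda>j1 j2. w j1 j2 \<cdot>\<^sub>v ((1\<^sub>m n - P) *\<^sub>v g j1 j2))"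
    and V_carrier: "vel_sum n Nv1 Nv2 (\<lambda>j1 j2. w j1 j2 \<cdot>\<^sub>v ((1\<^sub>m n - P) *\<^sub>v g j1 j2)) \<in> carrier_vec n"
    if g: "\<And>j1 j2. j1 \<in> {1..Nv1} \<Longrightarrow> j2 \<in> {1..Nv2} \<Longrightarrow> g j1 j2 \<in> carrier_vec n" for w g
  proof -
    have c: "w j1 j2 \<cdot>\<^sub>v ((1\<^sub>m n - P) *\<^sub>v g j1 j2) \<in> carrier_vec n"
      if "j1 \<in> {1..Nv1}" "j2 \<in> {1..Nv2}" for j1 j2
      using Qv[OF g[OF that]] by simp
    show "vel_sum n Nv1 Nv2 (\<lambda>j1 j2. w j1 j2 \<cdot>\<^sub>v ((1\<^sub>m n - P) *\<^sub>v g j1 j2)) \<in> carrier_vec n"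
      by (rule vel_sum_carrier) (rule c)
    have "vel_sum n Nv1 Nv2 (\<lambda>j1 j2. w j1 j2 \<cdot>\<^sub>v (G *\<^sub>v (X *\<^sub>v g j1 j2))) =
        vel_sum n Nv1 Nv2 (\<lambda>j1 j2. dt \<cdot>\<^sub>v (w j1 j2 \<cdot>\<^sub>v ((1\<^sub>m n - P) *\<^sub>v g j1 j2)))"
    proof (rule vel_sum_cong)
      fix j1 j2 assume j: "j1 \<in> {1..Nv1}" "j2 \<in> {1..Nv2}"
      show "dt \<cdot>\<^sub>v (w j1 j2 \<cdot>\<^sub>v ((1\<^sub>m n - P) *\<^sub>v g j1 j2)) \<in> carrier_vec n"
        using c[OF j] by simp
      show "w j1 j2 \<cdot>\<^sub>v (G *\<^sub>v (X *\<^sub>v g j1 j2)) = dt \<cdot>\<^sub>v (w j1 j2 \<cdot>\<^sub>v ((1\<^sub>m n - P) *\<^sub>v g j1 j2))"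
        unfolding GXv[OF g[OF j]] smult_smult_assoc by (simp only: mult.commute)
    qed
    also have "\<dots> = dt \<cdot>\<^sub>v vel_sum n Nv1 Nv2 (\<lambda>j1 j2. w j1 j2 \<cdot>\<^sub>v ((1\<^sub>m n - P) *\<^sub>v g j1 j2))"
      by (rule vel_sum_smult) (rule c)
    finally show "vel_sum n Nv1 Nv2 (\<lambda>j1 j2. w j1 j2 \<cdot>\<^sub>v (G *\<^sub>v (X *\<^sub>v g j1 j2))) =
      dt \<cdot>\<^sub>v vel_sum n Nv1 Nv2 (\<lambda>j1 j2. w j1 j2 \<cdot>\<^sub>v ((1\<^sub>m n - P) *\<^sub>v g j1 j2))" .
  qed
  have L'_action: "(dt \<cdot>\<^sub>m L) *\<^sub>v state n Nv1 Nv2 g B' E2' E1' = state n Nv1 Nv2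
        (\<lambda>j1 j2. v1 j1 \<cdot>\<^sub>v (X *\<^sub>v g j1 j2))
        (X *\<^sub>v E2')
        (X *\<^sub>v B' - c \<cdot>\<^sub>v vel_sum n Nv1 Nv2 (\<lambda>j1 j2. v2 j2 \<cdot>\<^sub>v (G *\<^sub>v (X *\<^sub>v g j1 j2))))
        (- (c \<cdot>\<^sub>v vel_sum n Nv1 Nv2 (\<lambda>j1 j2. v1 j1 \<cdot>\<^sub>v (G *\<^sub>v (X *\<^sub>v g j1 j2)))))"
    if g: "\<And>j1 j2. j1 \<in> {1..Nv1} \<Longrightarrow> j2 \<in> {1..Nv2} \<Longrightarrow> g j1 j2 \<in> carrier_vec n"
      and B': "B' \<in> carrier_vec n" and E2': "E2' \<in> carrier_vec n" and E1': "E1' \<in> carrier_vec n"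
    for g B' E2' E1'
  proof -
    define V where "V w = vel_sum n Nv1 Nv2 (\<lambda>j1 j2. w j1 j2 \<cdot>\<^sub>v ((1\<^sub>m n - P) *\<^sub>v g j1 j2))" for w
    have V: "V w \<in> carrier_vec n" for w unfolding V_def by (rule V_carrier) (rule g)
    have GXV: "vel_sum n Nv1 Nv2 (\<lambda>j1 j2. w j1 j2 \<cdot>\<^sub>v (G *\<^sub>v (X *\<^sub>v g j1 j2))) = dt \<cdot>\<^sub>v V w" for w
      unfolding V_def by (rule V_smult) (rule g)
    have "L *\<^sub>v state n Nv1 Nv2 g B' E2' E1' = state n Nv1 Nv2 (\<lambda>j1 j2. v1 j1 \<cdot>\<^sub>v (A *\<^sub>v g j1 j2))
        (A *\<^sub>v E2') (A *\<^sub>v B' - c \<cdot>\<^sub>v V (\<lambda>_ j2. v2 j2)) (- (c \<cdot>\<^sub>v V (\<lambda>j1 _. v1 j1)))"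
      unfolding V_def c_def using L_action g B' E2' E1' by blast
    then have "(dt \<cdot>\<^sub>m L) *\<^sub>v state n Nv1 Nv2 g B' E2' E1' =
        dt \<cdot>\<^sub>v state n Nv1 Nv2 (\<lambda>j1 j2. v1 j1 \<cdot>\<^sub>v (A *\<^sub>v g j1 j2))
          (A *\<^sub>v E2') (A *\<^sub>v B' - c \<cdot>\<^sub>v V (\<lambda>_ j2. v2 j2)) (- (c \<cdot>\<^sub>v V (\<lambda>j1 _. v1 j1)))"
      by (simp only: smult_mat_mult_vec[OF L_carrier state_carrier])
    also have "\<dots> = state n Nv1 Nv2 (\<lambda>j1 j2. dt \<cdot>\<^sub>v (v1 j1 \<cdot>\<^sub>v (A *\<^sub>v g j1 j2))) (dt \<cdot>\<^sub>v (A *\<^sub>v E2'))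
        (dt \<cdot>\<^sub>v (A *\<^sub>v B' - c \<cdot>\<^sub>v V (\<lambda>_ j2. v2 j2))) (dt \<cdot>\<^sub>v (- (c \<cdot>\<^sub>v V (\<lambda>j1 _. v1 j1))))"
      by (intro smult_state) (simp_all add: Av g B' E2' V)
    also have "\<dots> = state n Nv1 Nv2 (\<lambda>j1 j2. v1 j1 \<cdot>\<^sub>v (X *\<^sub>v g j1 j2)) (X *\<^sub>v E2')
        (X *\<^sub>v B' - c \<cdot>\<^sub>v (dt \<cdot>\<^sub>v V (\<lambda>_ j2. v2 j2))) (- (c \<cdot>\<^sub>v (dt \<cdot>\<^sub>v V (\<lambda>j1 _. v1 j1))))"
    proof (rule state_cong)
      show "dt \<cdot>\<^sub>v (v1 j1 \<cdot>\<^sub>v (A *\<^sub>v g j1 j2)) = v1 j1 \<cdot>\<^sub>v (X *\<^sub>v g j1 j2)"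
        if "j1 \<in> {1..Nv1}" "j2 \<in> {1..Nv2}" for j1 j2
        unfolding Xv[OF g[OF that]] smult_smult_assoc by (simp only: mult.commute)
      show "dt \<cdot>\<^sub>v (A *\<^sub>v E2') = X *\<^sub>v E2'" by (rule Xv[OF E2', symmetric])
      have "dt \<cdot>\<^sub>v (u - c \<cdot>\<^sub>v w) = dt \<cdot>\<^sub>v u - c \<cdot>\<^sub>v (dt \<cdot>\<^sub>v w)"
        if "u \<in> carrier_vec n" "w \<in> carrier_vec n" for u w
        using that by (intro eq_vecI) (auto simp: algebra_simps)
      from this[OF Av[OF B'] V]
      show "dt \<cdot>\<^sub>v (A *\<^sub>v B' - c \<cdot>\<^sub>v V (\<lambda>_ j2. v2 j2)) = X *\<^sub>v B' - c \<cdot>\<^sub>v (dt \<cdot>\<^sub>v V (\<lambda>_ j2. v2 j2))"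
        unfolding Xv[OF B'] .
      show "dt \<cdot>\<^sub>v (- (c \<cdot>\<^sub>v V (\<lambda>j1 _. v1 j1))) = - (c \<cdot>\<^sub>v (dt \<cdot>\<^sub>v V (\<lambda>j1 _. v1 j1)))"
        by (intro eq_vecI) auto
    qed
    finally show ?thesis unfolding GXV .
  qed
  have smult2: "x \<cdot>\<^sub>m (y \<cdot>\<^sub>m M) = (x * y) \<cdot>\<^sub>m M" for x y and M :: "real mat"
    by (intro eq_matI) auto
  have one: "1 \<cdot>\<^sub>m M = M" for M :: "real mat"
    by (intro eq_matI) auto
  have neg: "(- 1) \<cdot>\<^sub>m X = (- dt) \<cdot>\<^sub>m A"
    unfolding X_def smult2 by simp
  \<comment> \<open>Both orders of the product are needed: the exponentials acting on
    \<open>f\<close> carry \<open>v1 j1 * dt\<close>, while \<alpha> and \<beta> carry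
    \<open>dt * v1 j\<close>.\<close>
  have vX: "x \<cdot>\<^sub>m X = (x * dt) \<cdot>\<^sub>m A" and vX': "x \<cdot>\<^sub>m X = (dt * x) \<cdot>\<^sub>m A" for x
    unfolding X_def smult2 by (simp_all only: mult.commute)
  have "mat_exp (1 \<cdot>\<^sub>m (dt \<cdot>\<^sub>m L)) *\<^sub>v state n Nv1 Nv2 f B E2 E1 =
    state n Nv1 Nv2
      (\<lambda>j1 j2. mat_exp (v1 j1 \<cdot>\<^sub>m X) *\<^sub>v f j1 j2)
      (((1/2) \<cdot>\<^sub>m (mat_exp (1 \<cdot>\<^sub>m X) + mat_exp ((- 1) \<cdot>\<^sub>m X))) *\<^sub>v B
        + ((1/2) \<cdot>\<^sub>m (mat_exp (1 \<cdot>\<^sub>m X) - mat_exp ((- 1) \<cdot>\<^sub>m X))) *\<^sub>v E2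
        + c \<cdot>\<^sub>v (G *\<^sub>v vel_sum n Nv1 Nv2 (\<lambda>j1 j2. v2 j2 \<cdot>\<^sub>v (\<alpha> j1 *\<^sub>v f j1 j2))))
      (((1/2) \<cdot>\<^sub>m (mat_exp (1 \<cdot>\<^sub>m X) - mat_exp ((- 1) \<cdot>\<^sub>m X))) *\<^sub>v B
        + ((1/2) \<cdot>\<^sub>m (mat_exp (1 \<cdot>\<^sub>m X) + mat_exp ((- 1) \<cdot>\<^sub>m X))) *\<^sub>v E2
        + c \<cdot>\<^sub>v (G *\<^sub>v vel_sum n Nv1 Nv2 (\<lambda>j1 j2. v2 j2 \<cdot>\<^sub>v (\<beta> j1 *\<^sub>v f j1 j2))))
      (E1 + c \<cdot>\<^sub>v (G *\<^sub>v vel_sum n Nv1 Nv2 (\<lambda>j1 j2. (1\<^sub>m n - mat_exp (v1 j1 \<cdot>\<^sub>m X)) *\<^sub>v f j1 j2)))"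
  proof (rule mat_exp_state[OF X G XG _ L'_action])
    show "dt \<cdot>\<^sub>m L \<in> carrier_mat (state_dim n Nv1 Nv2) (state_dim n Nv1 Nv2)"
      using L_carrier by simp
    fix j assume j: "j \<in> {1..Nv1}"
    show "v1 j \<noteq> 1 \<and> v1 j \<noteq> - 1" using nonresonant j by blast
    show "\<alpha> j = (- 1 / (2 * (1 - v1 j))) \<cdot>\<^sub>m mat_exp (1 \<cdot>\<^sub>m X)
        - (1 / (2 * (1 + v1 j))) \<cdot>\<^sub>m mat_exp ((- 1) \<cdot>\<^sub>m X)
        + (1 / (1 - (v1 j)\<^sup>2)) \<cdot>\<^sub>m mat_exp (v1 j \<cdot>\<^sub>m X)"
      unfolding one neg unfolding vX' unfolding X_def using \<alpha> j by blast
    show "\<beta> j = (- 1 / (2 * (1 - v1 j))) \<cdot>\<^sub>m mat_exp (1 \<cdot>\<^sub>m X)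
        + (1 / (2 * (1 + v1 j))) \<cdot>\<^sub>m mat_exp ((- 1) \<cdot>\<^sub>m X)
        + (v1 j / (1 - (v1 j)\<^sup>2)) \<cdot>\<^sub>m mat_exp (v1 j \<cdot>\<^sub>m X)"
      unfolding one neg unfolding vX' unfolding X_def using \<beta> j by blast
  qed (use f B E2 E1 in auto)
  then show ?thesis
    using inv(1) unfolding one neg unfolding vX unfolding X_def c_def G_def by blast
qed

end
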